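(* Let $k\ge 3$ and $n\geq 2k+1$. Let $S$ be a vertex cut of $K(n,k)$ and $c=c(K(n,k)\setminus S)$. Then either $$\binom{n-k-1}{k-1}+1\leq c\leq \binom{n-1}{k-1}-\binom{n-k-1}{k-1}+1,$$ or $$\frac{|S|}{c}\geq \frac{n}{k}-1,$$ with equality in the latter if and only if $S$ is the complement of a maximum independent set of $K(n,k)$.
   Context: The Kneser graph $K(n,k)$ has as vertices the $k$-element subsets of $[n]=\{1,\dots,n\}$, two vertices being adjacent iff they are disjoint. A vertex cut is a set $S$ of vertices whose removal disconnects the graph; $c(G\setminus S)$ is the number of connected components after deleting $S$. *)

theory Defs
  imports Complex_Main
begin

text \<open>Kneser graph K(n,k): vertices are the k-subsets of {1..n}, adjacent iff disjoint.\<close>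

definition kneser_verts :: "nat \<Rightarrow> nat \<Rightarrow> nat set set" where
  "kneser_verts n k = {A. A \<subseteq> {1..n} \<and> card A = k}"

text \<open>Edge relation of the subgraph of the Kneser graph induced on a vertex set W.\<close>
definition kneser_edges :: "nat set set \<Rightarrow> (nat set \<times> nat set) set" where
  "kneser_edges W = {(A, B). A \<in> W \<and> B \<in> W \<and> A \<inter> B = {}}"

text \<open>Number of connected components of the subgraph induced on W.\<close>
definition num_components :: "nat set set \<Rightarrow> nat" where
  "num_components W = card (W // ((kneser_edges W)\<^sup>*))"

text \<open>S is a vertex cut of K(n,k): a set of vertices whose removal disconnects the graph.\<close>
definition kneser_vertex_cut :: "nat \<Rightarrow> nat \<Rightarrow> nat set set \<Rightarrow> bool" where
  "kneser_vertex_cut n k S \<longleftrightarrow> S \<subseteq> kneser_verts n k \<and>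
     num_components (kneser_verts n k - S) \<ge> 2"

definition kneser_independent :: "nat \<Rightarrow> nat \<Rightarrow> nat set set \<Rightarrow> bool" where
  "kneser_independent n k I \<longleftrightarrow> I \<subseteq> kneser_verts n k \<and>
     (\<forall>A\<in>I. \<forall>B\<in>I. A \<inter> B \<noteq> {})"

definition kneser_max_independent :: "nat \<Rightarrow> nat \<Rightarrow> nat set set \<Rightarrow> bool" where
  "kneser_max_independent n k I \<longleftrightarrow> kneser_independent n k I \<and>
     (\<forall>J. kneser_independent n k J \<longrightarrow> card J \<le> card I)"

end

theory Submission
  imports Defs "HOL-Combinatorics.Transposition"
begin

text \<open>
  A transversal of the components of \<open>K(n,k) - S\<close> is an intersecting family of size \<open>c\<close>. If \<open>c\<close>
  exceeds the Hilton--Milner bound, every transversal is a star; an edge \<open>AB\<close> in the remaining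
  graph would force the other \<open>c - 1\<close> representatives to share an element of \<open>A\<close> and an element
  of \<open>B\<close>, and there are too few such sets. Hence the remaining graph is edgeless,
  \<open>|S| = (n choose k) - c\<close>, and the claim is the Erdos--Ko--Rado bound on \<open>c\<close>.

  If \<open>c \<le> (n-k-1) choose (k-1)\<close>, the claim follows from \<open>|S| \<ge> d = (n-k) choose k\<close>, strictly if
  \<open>c \<ge> 3\<close>. For this take, among vertex sets \<open>P\<close> with at least \<open>t\<close> vertices inside and at least \<open>t\<close>
  outside the closed neighbourhood, one with smallest boundary and then smallest size. By
  submodularity of the boundary, a transposition of the ground set fixing \<open>t\<close> members of \<open>P\<close>
  fixes \<open>P\<close>. For \<open>t = 1\<close> this leaves only singletons; for \<open>t = 2\<close> it leaves few
  candidates, whose boundaries all have more than \<open>d\<close> elements.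

  The Hilton--Milner theorem is proved by the shifting argument of Frankl and Furedi: a suitably
  shifted family is already intersecting on a set of \<open>2k\<close> points, and its traces there
  are bounded by induction.
\<close>

section \<open>Uniform families\<close>

definition ksub :: "'a set \<Rightarrow> nat \<Rightarrow> 'a set set" where
  "ksub X k = {A. A \<subseteq> X \<and> card A = k}"

definition intersecting :: "'a set set \<Rightarrow> bool" where
  "intersecting F \<longleftrightarrow> (\<forall>A\<in>F. \<forall>B\<in>F. A \<inter> B \<noteq> {})"

text \<open>\<open>x\<close> ranges over the whole type, so the empty family counts as
  trivial.\<close>

definition nontrivial :: "'a set set \<Rightarrow> bool" where
  "nontrivial F \<longleftrightarrow> (\<forall>x. \<exists>A\<in>F. x \<notin> A)"

lemma finite_ksub: "finite X \<Longrightarrow> finite (ksub X k)"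
  unfolding ksub_def by (rule finite_subset[of _ "Pow X"]) auto

lemma card_ksub: "finite X \<Longrightarrow> card (ksub X k) = card X choose k"
  unfolding ksub_def by (rule n_subsets)

lemma card_star:
  assumes "finite X" "x \<in> X" "0 < i"
  shows "card {A \<in> ksub X i. x \<in> A} = (card X - 1) choose (i - 1)"
proof -
  have "bij_betw (insert x) (ksub (X - {x}) (i - 1)) {A \<in> ksub X i. x \<in> A}"
  proof (rule bij_betw_byWitness[where f' = "\<lambda>A. A - {x}"])
    show "\<forall>A\<in>ksub (X - {x}) (i - 1). insert x A - {x} = A"
      by (auto simp: ksub_def)
    show "insert x ` ksub (X - {x}) (i - 1) \<subseteq> {A \<in> ksub X i. x \<in> A}"
    proof (rule image_subsetI)
      fix A assume A: "A \<in> ksub (X - {x}) (i - 1)"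
      then have "finite A" "x \<notin> A"
        using assms(1) by (auto simp: ksub_def intro: finite_subset)
      then show "insert x A \<in> {A \<in> ksub X i. x \<in> A}"
        using A assms by (auto simp: ksub_def)
    qed
    show "(\<lambda>A. A - {x}) ` {A \<in> ksub X i. x \<in> A} \<subseteq> ksub (X - {x}) (i - 1)"
      by (auto simp: ksub_def)
  qed auto
  then have "card {A \<in> ksub X i. x \<in> A} = card (ksub (X - {x}) (i - 1))"
    by (simp add: bij_betw_same_card)
  then show ?thesis
    using assms by (simp add: card_ksub)
qed

text \<open>The star members avoiding \<open>B\<close> form a star in \<open>T - B\<close>. The
  additive form avoids truncated subtraction.\<close>

lemma card_star_meeting:
  assumes "finite T" "x \<in> T" "0 < i" "B \<subseteq> T" "x \<notin> B"
  shows "card {A \<in> ksub T i. x \<in> A \<and> A \<inter> B \<noteq> {}} + ((card T - card B - 1) choose (i - 1))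
    = (card T - 1) choose (i - 1)"
proof -
  have fB: "finite B"
    using assms by (auto intro: finite_subset)
  have split: "{A \<in> ksub T i. x \<in> A} =
      {A \<in> ksub T i. x \<in> A \<and> A \<inter> B \<noteq> {}} \<union> {A \<in> ksub (T - B) i. x \<in> A}"
    by (auto simp: ksub_def)
  have "card {A \<in> ksub T i. x \<in> A} =
      card {A \<in> ksub T i. x \<in> A \<and> A \<inter> B \<noteq> {}} + card {A \<in> ksub (T - B) i. x \<in> A}"
    unfolding split using assms(1)
    by (intro card_Un_disjoint) (auto simp: finite_ksub ksub_def)
  moreover have "card {A \<in> ksub (T - B) i. x \<in> A} = (card T - card B - 1) choose (i - 1)"
    using assms fB by (subst card_star) (auto simp: card_Diff_subset)
  ultimately show ?thesis
    using card_star[OF assms(1-3)] by simp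
qed

text \<open>Complementation in \<open>T\<close> sends \<open>G\<close> injectively to
  \<open>k\<close>-sets outside \<open>G\<close>, since a set never meets its complement.\<close>

lemma two_card_intersecting_middle:
  assumes "finite T" "card T = 2 * k" "G \<subseteq> ksub T k" "intersecting G"
  shows "2 * card G \<le> (2 * k) choose k"
proof -
  let ?H = "(\<lambda>A. T - A) ` G"
  have finG: "finite G"
    using assms finite_ksub finite_subset by blast
  have "inj_on (\<lambda>A. T - A) G"
    using assms(3) by (intro inj_onI) (auto simp: ksub_def, blast+)
  then have cH: "card ?H = card G"
    by (rule card_image)
  have "?H \<subseteq> ksub T k"
  proof (rule image_subsetI)
    fix A assume "A \<in> G"
    then have "A \<subseteq> T" "card A = k"
      using assms(3) by (auto simp: ksub_def)
    then show "T - A \<in> ksub T k"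
      using assms(1,2) by (auto simp: ksub_def card_Diff_subset finite_subset)
  qed
  moreover have "G \<inter> ?H = {}"
    using assms(4) by (auto simp: intersecting_def)
  ultimately have "card G + card ?H \<le> card (ksub T k)"
    using assms finG by (subst card_Un_disjoint[symmetric]) (auto intro!: card_mono finite_ksub)
  then show ?thesis
    using cH assms by (simp add: card_ksub)
qed

section \<open>Shifting\<close>

text \<open>The Erdos-Ko-Rado compression from \<open>b\<close> to \<open>a\<close>. Blocking a move
  whose target is already in \<open>F\<close> makes it injective on \<open>F\<close>.\<close>

definition shift :: "'a \<Rightarrow> 'a \<Rightarrow> 'a set set \<Rightarrow> 'a set \<Rightarrow> 'a set" where
  "shift a b F A =
    (if b \<in> A \<and> a \<notin> A \<and> insert a (A - {b}) \<notin> F then insert a (A - {b}) else A)"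

lemma inj_on_shift: "inj_on (shift a b F) F"
proof (rule inj_onI)
  fix A B assume AB: "A \<in> F" "B \<in> F" "shift a b F A = shift a b F B"
  have "A = B" if "insert a (A - {b}) = insert a (B - {b})" "b \<in> A" "b \<in> B" "a \<notin> A" "a \<notin> B"
    using that by (metis Diff_insert_absorb insert_Diff Diff_iff)
  then show "A = B"
    using AB unfolding shift_def by (metis (full_types))
qed

lemma card_shift: "card (shift a b F ` F) = card F"
  by (rule card_image[OF inj_on_shift])

lemma shift_in_ksub:
  assumes "finite X" "a \<in> X" "F \<subseteq> ksub X k"
  shows "shift a b F ` F \<subseteq> ksub X k"
proof (rule image_subsetI)
  fix A assume "A \<in> F"
  then have A: "A \<subseteq> X" "card A = k" "finite A"
    using assms by (auto simp: ksub_def intro: finite_subset)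
  have "card (insert a (A - {b})) = k" if "b \<in> A" "a \<notin> A"
    using that A card_Suc_Diff1[of A b] by simp
  then show "shift a b F A \<in> ksub X k"
    using A assms(2) by (auto simp: shift_def ksub_def)
qed

text \<open>The delicate pair is a moved \<open>A\<close> and an unmoved \<open>B\<close> with
  \<open>b\<close> in \<open>B\<close> and \<open>a\<close> not. Then \<open>B\<close> stayed
  because \<open>insert a (B - {b})\<close> is in \<open>F\<close>; that set meets \<open>A\<close>
  outside \<open>{a, b}\<close>, where the moved \<open>A\<close> meets \<open>B\<close>.\<close>

lemma intersecting_shift:
  assumes "intersecting F"
  shows "intersecting (shift a b F ` F)"
proof -
  have mixed: "insert a (A - {b}) \<inter> B \<noteq> {}"
    if A: "A \<in> F" "b \<in> A" "a \<notin> A"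
      and B: "B \<in> F" "\<not> (b \<in> B \<and> a \<notin> B \<and> insert a (B - {b}) \<notin> F)" for A B
  proof (cases "a \<in> B \<or> b \<notin> B")
    case True
    moreover have "A \<inter> B \<noteq> {}"
      using assms A B by (auto simp: intersecting_def)
    ultimately show ?thesis
      by blast
  next
    case False
    then have "insert a (B - {b}) \<in> F"
      using B by blast
    then have "A \<inter> insert a (B - {b}) \<noteq> {}"
      using assms A unfolding intersecting_def by blast
    then show ?thesis
      using A by blast
  qed
  show ?thesis
    unfolding intersecting_def
  proof (intro ballI)
    fix A' B' assume "A' \<in> shift a b F ` F" "B' \<in> shift a b F ` F"
    then obtain A B where AB: "A \<in> F" "A' = shift a b F A" "B \<in> F" "B' = shift a b F B"
      by blast
    then have "A \<inter> B \<noteq> {}"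
      using assms unfolding intersecting_def by blast
    moreover have "insert a (A - {b}) \<inter> insert a (B - {b}) \<noteq> {}"
      by blast
    ultimately show "A' \<inter> B' \<noteq> {}"
      using mixed[of A B] mixed[of B A] AB(1,3) unfolding AB(2,4) shift_def Int_commute[of _ A]
      by (simp add: Int_commute split: if_splits)
  qed
qed

text \<open>An effective shift replaces \<open>b\<close> by the smaller \<open>a\<close> and lowers
  the total of all elements, so a family of least total is stable. \<open>Q\<close> carries the
  invariants to be kept.\<close>

lemma shift_stable_exists:
  fixes F :: "nat set set"
  assumes "Q F"
    and fin: "\<And>F. Q F \<Longrightarrow> finite F \<and> (\<forall>A\<in>F. finite A)"
    and step: "\<And>F a b. Q F \<Longrightarrow> a \<in> Y \<Longrightarrow> b \<in> Y \<Longrightarrow> a < b \<Longrightarrow> Q (shift a b F ` F)"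
  obtains G where "Q G"
    "\<And>a b A. a \<in> Y \<Longrightarrow> b \<in> Y \<Longrightarrow> a < b \<Longrightarrow> A \<in> G \<Longrightarrow> b \<in> A \<Longrightarrow> a \<notin> A
      \<Longrightarrow> insert a (A - {b}) \<in> G"
proof -
  define w where "w F = (\<Sum>A\<in>F. \<Sum>A)" for F :: "nat set set"
  obtain G where G: "Q G" and min: "\<And>H. Q H \<Longrightarrow> w G \<le> w H"
    using ex_has_least_nat[of Q F w] assms(1) by blast
  have "insert a (A - {b}) \<in> G"
    if ab: "a \<in> Y" "b \<in> Y" "a < b" and A: "A \<in> G" "b \<in> A" "a \<notin> A" for a b A
  proof (rule ccontr)
    assume "insert a (A - {b}) \<notin> G"
    have less: "\<Sum>(insert a (B - {b})) < \<Sum>B" if "B \<in> G" "b \<in> B" "a \<notin> B" for B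
      using fin[OF G] that ab(3) by (simp add: sum.remove[of B b])
    have "w (shift a b G ` G) = (\<Sum>B\<in>G. \<Sum>(shift a b G B))"
      unfolding w_def by (simp add: sum.reindex[OF inj_on_shift])
    also have "\<dots> < w G"
      unfolding w_def
    proof (rule sum_strict_mono_ex1)
      show "\<forall>B\<in>G. \<Sum>(shift a b G B) \<le> \<Sum>B"
        using less by (auto simp: shift_def intro: less_imp_le)
      show "\<exists>B\<in>G. \<Sum>(shift a b G B) < \<Sum>B"
        using less A \<open>insert a (A - {b}) \<notin> G\<close> by (intro bexI[of _ A]) (auto simp: shift_def)
    qed (use fin[OF G] in simp)
    finally show False
      using min[OF step[OF G ab]] by simp
  qed
  then show thesis
    using that G by blast
qed

lemma initial_segment_exists:
  fixes Y :: "nat set"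
  assumes "finite Y" "m \<le> card Y"
  shows "\<exists>Z\<subseteq>Y. card Z = m \<and> (\<forall>z\<in>Z. \<forall>y\<in>Y - Z. z < y)"
  using assms(2)
proof (induction m)
  case 0
  then show ?case
    by (intro exI[of _ "{}"]) auto
next
  case (Suc m)
  then obtain Z where Z: "Z \<subseteq> Y" "card Z = m" "\<forall>z\<in>Z. \<forall>y\<in>Y - Z. z < y"
    by auto
  have fin: "finite (Y - Z)" "finite Z"
    using assms(1) Z(1) finite_subset by auto
  have ne: "Y - Z \<noteq> {}"
    using Suc.prems Z by auto
  define y where "y = Min (Y - Z)"
  have y: "y \<in> Y - Z" "\<forall>x\<in>Y - Z. y \<le> x"
    using Min_in[OF fin(1) ne] Min_le[OF fin(1)] by (auto simp: y_def)
  then show ?case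
    using Z fin by (intro exI[of _ "insert y Z"]) (auto simp: order_le_less)
qed

text \<open>For \<open>D = {}\<close> the family is shifted on the whole ground set; for \<open>D = {i, j}\<close> every member
  meets \<open>D\<close> and the family is shifted only off \<open>D\<close>.\<close>

lemma shifted_trace_intersecting:
  fixes X :: "nat set"
  assumes "finite X" "2 * k \<le> card X" "F \<subseteq> ksub X k" "intersecting F"
    and D: "D \<subseteq> X" "card D \<le> 2 * k" "\<And>A. A \<in> F \<Longrightarrow> card D \<le> 2 * card (A \<inter> D)"
    and stable: "\<And>a b A. a \<in> X - D \<Longrightarrow> b \<in> X - D \<Longrightarrow> a < b \<Longrightarrow> A \<in> F \<Longrightarrow> b \<in> A \<Longrightarrow> a \<notin> A
      \<Longrightarrow> insert a (A - {b}) \<in> F"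
  obtains T where "T \<subseteq> X" "card T = 2 * k" "\<And>A B. A \<in> F \<Longrightarrow> B \<in> F \<Longrightarrow> A \<inter> B \<inter> T \<noteq> {}"
proof -
  have finD: "finite D"
    using assms finite_subset by blast
  have "2 * k - card D \<le> card (X - D)"
    using assms(2) D by (simp add: card_Diff_subset[OF finD])
  then obtain Z where Z: "Z \<subseteq> X - D" "card Z = 2 * k - card D" "\<forall>z\<in>Z. \<forall>y\<in>X - D - Z. z < y"
    using initial_segment_exists[OF finite_Diff[OF assms(1)]] by metis
  have finZ: "finite Z"
    using Z(1) assms(1) finite_subset by blast
  define T where "T = D \<union> Z"
  \<comment> \<open>If \<open>A\<close> and \<open>B\<close> met only outside \<open>T\<close>,
    exchanging a common \<open>b\<close> for an \<open>a\<close> in \<open>Z\<close> outside both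
    would give a member meeting \<open>B\<close> in fewer points, still only outside
    \<open>T\<close>.\<close>
  have "A \<inter> B \<inter> T \<noteq> {}" if "A \<in> F" "B \<in> F" for A B
    using that
  proof (induction "card (A \<inter> B)" arbitrary: A rule: less_induct)
    case less
    show ?case
    proof
      assume disj: "A \<inter> B \<inter> T = {}"
      have AX: "A \<subseteq> X" "card A = k" "B \<subseteq> X" "card B = k"
        using less.prems assms(3) by (auto simp: ksub_def)
      then have fin: "finite A" "finite B"
        using assms(1) finite_subset by blast+
      obtain b where b: "b \<in> A" "b \<in> B"
        using less.prems assms(4) by (auto simp: intersecting_def)
      then have bT: "b \<notin> D" "b \<notin> Z"
        using disj by (auto simp: T_def)
      have part: "card (C \<inter> D) + card (C \<inter> Z) < k" if "b \<in> C" "finite C" "card C = k" for C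
      proof -
        have "card (C \<inter> D) + card (C \<inter> Z) = card ((C \<inter> D) \<union> (C \<inter> Z))"
          using finD finZ Z(1) by (intro card_Un_disjoint[symmetric]) auto
        also have "\<dots> < card C"
          using that bT by (intro psubset_card_mono) auto
        finally show ?thesis
          using that by simp
      qed
      \<comment> \<open>Each set has at least half of \<open>card D\<close> points in
        \<open>D\<close> and the point \<open>b\<close> outside \<open>T\<close>, so together they
        cover at most \<open>2 * k - 2 - card D\<close> points of \<open>Z\<close>.\<close>
      have "card ((A \<union> B) \<inter> Z) \<le> card (A \<inter> Z) + card (B \<inter> Z)"
        by (simp add: Int_Un_distrib2 card_Un_le)
      also have "\<dots> < card Z"
        using part[of A] part[of B] b fin AX D(3)[OF less.prems(1)] D(3)[OF less.prems(2)] Z(2)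
        by linarith
      finally have "(A \<union> B) \<inter> Z \<noteq> Z"
        by auto
      then obtain a where a: "a \<in> Z" "a \<notin> A" "a \<notin> B"
        by blast
      define A' where "A' = insert a (A - {b})"
      have "a < b"
        using Z(3) a b bT AX by blast
      then have "A' \<in> F"
        unfolding A'_def using stable[of a b A] less.prems a b bT AX Z(1) by blast
      moreover have "A' \<inter> B = A \<inter> B - {b}"
        using a by (auto simp: A'_def)
      moreover have "card (A \<inter> B - {b}) < card (A \<inter> B)"
        using b fin by (intro card_Diff1_less) auto
      ultimately have "A' \<inter> B \<inter> T \<noteq> {}"
        using less.hyps[of A'] less.prems by simp
      then show False
        using disj \<open>A' \<inter> B = A \<inter> B - {b}\<close> by blast
    qed
  qed
  moreover have "T \<subseteq> X"
    using Z D by (auto simp: T_def)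
  moreover have "card T = 2 * k"
    unfolding T_def using Z D finD finZ by (subst card_Un_disjoint) auto
  ultimately show thesis
    using that by blast
qed

section \<open>The Hilton--Milner theorem\<close>

lemma vandermonde_pred:
  assumes "0 < k"
  shows "(\<Sum>i=1..k. (m choose (i - 1)) * (l choose (k - i))) = (m + l) choose (k - 1)"
proof -
  have "(\<Sum>i=1..k. (m choose (i - 1)) * (l choose (k - i)))
      = (\<Sum>i\<le>k - 1. (m choose i) * (l choose (k - 1 - i)))"
    using assms by (intro sum.reindex_bij_witness[of _ Suc "\<lambda>i. i - 1"]) auto
  also have "\<dots> = (m + l) choose (k - 1)"
    by (rule vandermonde)
  finally show ?thesis .
qed

lemma nontrivial_intersecting_uniformity_ge_2:
  assumes "F \<subseteq> ksub X k" "finite X" "intersecting F" "nontrivial F"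
  shows "2 \<le> k"
proof (rule ccontr)
  assume "\<not> 2 \<le> k"
  obtain A where A: "A \<in> F"
    using assms(4) by (auto simp: nontrivial_def)
  then have "A \<noteq> {}" "card A = k" "finite A"
    using assms by (auto simp: intersecting_def ksub_def intro: finite_subset)
  then have "card A = 1"
    using \<open>\<not> 2 \<le> k\<close> card_gt_0_iff[of A] by linarith
  then obtain x where x: "A = {x}"
    by (auto simp: card_1_singleton_iff)
  obtain B where "B \<in> F" "x \<notin> B"
    using assms(4) by (auto simp: nontrivial_def)
  then have "A \<inter> B = {}"
    using x by auto
  then show False
    using assms(3) A \<open>B \<in> F\<close> unfolding intersecting_def by blast
qed

text \<open>Members are sorted by the size \<open>i\<close> of their trace on \<open>T\<close>. The
  traces of one size form an intersecting family bounded by \<open>card_tr\<close>; weighting with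
  the choices outside \<open>T\<close> and applying Vandermonde to both sides sums these
  bounds.\<close>

lemma card_le_of_trace_intersecting:
  assumes "finite X" "T \<subseteq> X" "card T = 2 * k" "2 * k \<le> card X" "0 < k"
    and F: "F \<subseteq> ksub X k" "nontrivial F"
    and trace: "\<And>A B. A \<in> F \<Longrightarrow> B \<in> F \<Longrightarrow> A \<inter> B \<inter> T \<noteq> {}"
    and IH: "\<And>i G. i < k \<Longrightarrow> G \<subseteq> ksub T i \<Longrightarrow> intersecting G \<Longrightarrow> nontrivial G
      \<Longrightarrow> card G + ((2 * k - i - 1) choose (i - 1)) \<le> ((2 * k - 1) choose (i - 1)) + 1"
  shows "card F + ((card X - k - 1) choose (k - 1)) \<le> ((card X - 1) choose (k - 1)) + 1"
proof -
  define n where "n = card X"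
  define tr where "tr i = {A \<inter> T |A. A \<in> F \<and> card (A \<inter> T) = i}" for i
  have finT: "finite T"
    using assms finite_subset by blast
  have tr_sub: "tr i \<subseteq> ksub T i" for i
    by (auto simp: tr_def ksub_def)
  have tr_int: "intersecting (tr i)" for i
    unfolding intersecting_def
  proof (intro ballI)
    fix P Q assume "P \<in> tr i" "Q \<in> tr i"
    then obtain A B where "A \<in> F" "B \<in> F" "P = A \<inter> T" "Q = B \<inter> T"
      by (auto simp: tr_def)
    then show "P \<inter> Q \<noteq> {}"
      using trace[of A B] by blast
  qed
  have tr_fin: "finite (tr i)" for i
    using tr_sub finite_ksub[OF finT] finite_subset by blast
  have card_F: "card F \<le> (\<Sum>i=1..k. card (tr i) * ((n - 2 * k) choose (k - i)))"
  proof -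
    let ?pairs = "\<lambda>i. tr i \<times> ksub (X - T) (k - i)"
    have fin: "finite (?pairs i)" for i
      using tr_fin finite_ksub[OF finite_Diff[OF assms(1)]] by (rule finite_cartesian_product)
    have "F \<subseteq> (\<Union>i\<in>{1..k}. (\<lambda>(P, Q). P \<union> Q) ` ?pairs i)"
    proof
      fix A assume A: "A \<in> F"
      then have A': "A \<subseteq> X" "card A = k" "finite A"
        using F(1) assms(1) by (auto simp: ksub_def intro: finite_subset)
      have "card (A \<inter> T) + card (A - T) = k"
        using A' by (metis card_Int_Diff)
      moreover have "0 < card (A \<inter> T)"
        using trace[OF A A] A' by (simp add: card_gt_0_iff)
      ultimately have "card (A \<inter> T) \<in> {1..k}" "A - T \<in> ksub (X - T) (k - card (A \<inter> T))"
        using A' unfolding ksub_def by (simp, force)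
      moreover have "A \<inter> T \<in> tr (card (A \<inter> T))"
        using A by (auto simp: tr_def)
      moreover have "A = (A \<inter> T) \<union> (A - T)"
        by blast
      ultimately show "A \<in> (\<Union>i\<in>{1..k}. (\<lambda>(P, Q). P \<union> Q) ` ?pairs i)"
        by (intro UN_I[of "card (A \<inter> T)"] image_eqI[of _ _ "(A \<inter> T, A - T)"]) auto
    qed
    then have "card F \<le> card (\<Union>i\<in>{1..k}. (\<lambda>(P, Q). P \<union> Q) ` ?pairs i)"
      using fin by (intro card_mono) auto
    also have "\<dots> \<le> (\<Sum>i=1..k. card ((\<lambda>(P, Q). P \<union> Q) ` ?pairs i))"
      by (rule card_UN_le) simp
    also have "\<dots> \<le> (\<Sum>i=1..k. card (?pairs i))"
      using fin by (intro sum_mono card_image_le) auto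
    also have "\<dots> = (\<Sum>i=1..k. card (tr i) * ((n - 2 * k) choose (k - i)))"
      using assms finT by (simp add: card_cartesian_product card_ksub card_Diff_subset n_def)
    finally show ?thesis .
  qed
  \<comment> \<open>At \<open>i = k\<close> the halving bound is used and the added binomial on the
    left is 1; this is the source of the single \<open>+ 1\<close> in the conclusion.\<close>
  have card_tr: "card (tr i) + ((k - 1) choose (i - 1))
      \<le> ((2 * k - 1) choose (i - 1)) + (if i = k then 1 else 0)" if i: "i \<in> {1..k}" for i
  proof (cases "i = k")
    case True
    have "2 * card (tr k) \<le> (2 * k) choose k"
      using two_card_intersecting_middle[OF finT assms(3) tr_sub tr_int] .
    also have "k * \<dots> = k * (2 * ((2 * k - 1) choose (k - 1)))"
      using times_binomial_minus1_eq[of k "2 * k"] assms(5) by simp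
    then have "(2 * k) choose k = 2 * ((2 * k - 1) choose (k - 1))"
      using assms(5) by simp
    finally show ?thesis
      using True by simp
  next
    case False
    then have ik: "1 \<le> i" "i < k"
      using i by auto
    show ?thesis
    proof (cases "nontrivial (tr i)")
      case True
      then have i2: "2 \<le> i"
        using nontrivial_intersecting_uniformity_ge_2[OF tr_sub finT tr_int] by blast
      \<comment> \<open>For \<open>i < k\<close> this slack absorbs the \<open>+ 1\<close> of the
        induction hypothesis.\<close>
      have "((k - 1) choose (i - 1)) + 1 \<le> k choose (i - 1)"
        using choose_reduce_nat[of k "i - 1"] zero_less_binomial[of "i - 1 - 1" "k - 1"] ik i2
        by linarith
      also have "\<dots> \<le> (2 * k - i - 1) choose (i - 1)"
        using ik by (intro binomial_right_mono) auto
      finally show ?thesis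
        using IH[OF ik(2) tr_sub tr_int True] False by simp
    next
      case triv: False
      then obtain x where x: "\<And>P. P \<in> tr i \<Longrightarrow> x \<in> P"
        by (auto simp: nontrivial_def)
      show ?thesis
      proof (cases "tr i = {}")
        case True
        then show ?thesis
          using ik by (simp add: binomial_right_mono)
      next
        case ne: False
        then have xT: "x \<in> T"
          using x tr_sub[of i] unfolding ksub_def by blast
        \<comment> \<open>Although the traces share \<open>x\<close>, \<open>F\<close> itself is
          nontrivial. Every trace must meet the at most \<open>k\<close> points of \<open>B\<close>
          in \<open>T\<close>.\<close>
        obtain B where B: "B \<in> F" "x \<notin> B"
          using F(2) by (auto simp: nontrivial_def)
        have finB: "finite B" "card B = k"
          using B F(1) assms(1) by (auto simp: ksub_def intro: finite_subset)
        have "tr i \<subseteq> {P \<in> ksub T i. x \<in> P \<and> P \<inter> (B \<inter> T) \<noteq> {}}"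
        proof
          fix P assume P: "P \<in> tr i"
          then obtain A where "A \<in> F" "P = A \<inter> T"
            by (auto simp: tr_def)
          then have "P \<inter> (B \<inter> T) \<noteq> {}"
            using trace[OF _ B(1), of A] by blast
          then show "P \<in> {P \<in> ksub T i. x \<in> P \<and> P \<inter> (B \<inter> T) \<noteq> {}}"
            using P x tr_sub by auto
        qed
        then have "card (tr i) \<le> card {P \<in> ksub T i. x \<in> P \<and> P \<inter> (B \<inter> T) \<noteq> {}}"
          using finite_ksub[OF finT] by (intro card_mono) auto
        then have "card (tr i) + ((2 * k - card (B \<inter> T) - 1) choose (i - 1))
            \<le> (2 * k - 1) choose (i - 1)"
          using card_star_meeting[OF finT xT, of i "B \<inter> T"] ik B assms(3) by simp
        moreover have "(k - 1) choose (i - 1) \<le> (2 * k - card (B \<inter> T) - 1) choose (i - 1)"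
          using card_mono[of B "B \<inter> T"] finB by (intro binomial_right_mono) auto
        ultimately show ?thesis
          by simp
      qed
    qed
  qed
  let ?b = "\<lambda>i. (n - 2 * k) choose (k - i)"
  have "card F + ((k - 1 + (n - 2 * k)) choose (k - 1))
      \<le> (\<Sum>i=1..k. card (tr i) * ?b i) + (\<Sum>i=1..k. ((k - 1) choose (i - 1)) * ?b i)"
    unfolding vandermonde_pred[OF assms(5)] using card_F by simp
  also have "\<dots> = (\<Sum>i=1..k. (card (tr i) + ((k - 1) choose (i - 1))) * ?b i)"
    by (simp add: sum.distrib distrib_right)
  also have "\<dots> \<le> (\<Sum>i=1..k. (((2 * k - 1) choose (i - 1)) + (if i = k then 1 else 0)) * ?b i)"
    by (intro sum_mono mult_right_mono card_tr) auto
  also have "\<dots> = (\<Sum>i=1..k. ((2 * k - 1) choose (i - 1)) * ?b i)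
      + (\<Sum>i=1..k. if i = k then ?b i else 0)"
    unfolding sum.distrib[symmetric] by (intro sum.cong) (auto simp: distrib_right)
  also have "\<dots> = ((2 * k - 1 + (n - 2 * k)) choose (k - 1)) + 1"
    unfolding vandermonde_pred[OF assms(5)] using assms(5) by simp
  finally show ?thesis
    using assms(4,5) by (simp add: n_def)
qed

text \<open>The families to which the Hilton--Milner theorem applies, not its extremal
  examples.\<close>

definition HM_family :: "'a set \<Rightarrow> nat \<Rightarrow> 'a set set \<Rightarrow> bool" where
  "HM_family X k F \<longleftrightarrow> F \<subseteq> ksub X k \<and> intersecting F \<and> nontrivial F"

text \<open>A common element created by the shift must be \<open>a\<close>, the only element that
  shifting adds. So each member had \<open>a\<close> already or gained it in exchange for
  \<open>b\<close>.\<close>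

lemma nontrivial_shift_or_pair:
  assumes "nontrivial F" "\<not> nontrivial (shift a b F ` F)" "A \<in> F"
  shows "A \<inter> {a, b} \<noteq> {}"
proof -
  obtain x where x: "\<And>A. A \<in> F \<Longrightarrow> x \<in> shift a b F A"
    using assms(2) by (auto simp: nontrivial_def)
  obtain B where "B \<in> F" "x \<notin> B"
    using assms(1) by (auto simp: nontrivial_def)
  then have "x = a"
    using x[of B] by (auto simp: shift_def split: if_splits)
  then show ?thesis
    using x[OF assms(3)] by (auto simp: shift_def split: if_splits)
qed

text \<open>Induction on \<open>k\<close>, with a family of maximum size. Shifting may destroy
  nontriviality only if all members meet some pair \<open>{i, j}\<close>; in that case shifts are
  confined to the points off the pair.\<close>

theorem hilton_milner:
  fixes X :: "nat set"
  assumes "finite X" "2 * k + 1 \<le> card X" "HM_family X k F"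
  shows "card F + ((card X - k - 1) choose (k - 1)) \<le> ((card X - 1) choose (k - 1)) + 1"
  using assms
proof (induction k arbitrary: X F rule: less_induct)
  case (less k)
  have k2: "2 \<le> k"
    using nontrivial_intersecting_uniformity_ge_2 less.prems by (auto simp: HM_family_def)
  have finF: "finite G \<and> (\<forall>A\<in>G. finite A)" if "HM_family X k G" for G
    using that less.prems(1) finite_ksub[of X k]
    by (auto simp: HM_family_def ksub_def intro: finite_subset)
  have bound: "card G \<le> card (ksub X k)" if "HM_family X k G" for G
    using that less.prems(1) by (auto simp: HM_family_def finite_ksub intro: card_mono)
  obtain M where M: "HM_family X k M" and max: "\<And>G. HM_family X k G \<Longrightarrow> card G \<le> card M"
    using ex_has_greatest_nat[of "HM_family X k" F card "Suc (card (ksub X k))"] bound less.prems(3)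
    by (metis less_Suc_eq_le)
  have finish: ?case if G: "HM_family X k G" "card G = card M"
    and D: "D \<subseteq> X" "card D \<le> 2" "\<And>A. A \<in> G \<Longrightarrow> card D \<le> 2 * card (A \<inter> D)"
    and stable: "\<And>a b A. a \<in> X - D \<Longrightarrow> b \<in> X - D \<Longrightarrow> a < b \<Longrightarrow> A \<in> G \<Longrightarrow> b \<in> A \<Longrightarrow> a \<notin> A
      \<Longrightarrow> insert a (A - {b}) \<in> G" for G D
  proof -
    obtain T where T: "T \<subseteq> X" "card T = 2 * k" "\<And>A B. A \<in> G \<Longrightarrow> B \<in> G \<Longrightarrow> A \<inter> B \<inter> T \<noteq> {}"
      using shifted_trace_intersecting[of X k G D] less.prems(1,2) G D stable k2
      by (auto simp: HM_family_def)
    have "card G + ((card X - k - 1) choose (k - 1)) \<le> ((card X - 1) choose (k - 1)) + 1"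
    proof (rule card_le_of_trace_intersecting[OF less.prems(1) T(1,2) _ _ _ _ T(3)])
      \<comment> \<open>\<open>i < k\<close> gives \<open>2 * i + 1 \<le> 2 * k\<close>, so the
        induction hypothesis applies on \<open>T\<close>.\<close>
      fix i H assume "i < k" "H \<subseteq> ksub T i" "intersecting H" "nontrivial H"
      then show "card H + ((2 * k - i - 1) choose (i - 1)) \<le> ((2 * k - 1) choose (i - 1)) + 1"
        using less.IH[of i T H] T less.prems(1) by (auto simp: HM_family_def intro: finite_subset)
    qed (use less.prems k2 G in \<open>auto simp: HM_family_def\<close>)
    then show ?case
      using max[OF less.prems(3)] G(2) by simp
  qed
  show ?case
  proof (cases "\<exists>G i j. HM_family X k G \<and> card G = card M \<and> i \<in> X \<and> j \<in> X \<and> i \<noteq> j \<and>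
      (\<forall>A\<in>G. A \<inter> {i, j} \<noteq> {})")
    case False
    let ?Q = "\<lambda>G. HM_family X k G \<and> card G = card M"
    obtain G where "?Q G" "\<And>a b A. a \<in> X \<Longrightarrow> b \<in> X \<Longrightarrow> a < b \<Longrightarrow> A \<in> G \<Longrightarrow> b \<in> A \<Longrightarrow> a \<notin> A
      \<Longrightarrow> insert a (A - {b}) \<in> G"
    proof (rule shift_stable_exists[of ?Q M X])
      show "?Q M"
        using M by simp
      fix H assume H: "?Q H"
      then show "finite H \<and> (\<forall>A\<in>H. finite A)"
        using finF by blast
      fix a b assume ab: "a \<in> X" "b \<in> X" "a < b"
      have "nontrivial (shift a b H ` H)"
      proof (rule ccontr)
        assume "\<not> nontrivial (shift a b H ` H)"
        then have "\<forall>A\<in>H. A \<inter> {a, b} \<noteq> {}"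
          using nontrivial_shift_or_pair[of H a b] H unfolding HM_family_def by blast
        then show False
          using False H ab by blast
      qed
      then show "?Q (shift a b H ` H)"
        using H ab less.prems(1)
        by (simp add: HM_family_def card_shift intersecting_shift shift_in_ksub)
    qed blast
    then show ?thesis
      using finish[of G "{}"] by simp
  next
    case True
    then obtain G0 i j where G0: "HM_family X k G0" "card G0 = card M"
      and ij: "i \<in> X" "j \<in> X" "i \<noteq> j" and meet: "\<forall>A\<in>G0. A \<inter> {i, j} \<noteq> {}"
      by blast
    let ?Q = "\<lambda>G. HM_family X k G \<and> card G = card M \<and> (\<forall>A\<in>G. A \<inter> {i, j} \<noteq> {})"
    obtain G where G: "?Q G"
      "\<And>a b A. a \<in> X - {i, j} \<Longrightarrow> b \<in> X - {i, j} \<Longrightarrow> a < b \<Longrightarrow> A \<in> G \<Longrightarrow> b \<in> A \<Longrightarrow> a \<notin> A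
      \<Longrightarrow> insert a (A - {b}) \<in> G"
    proof (rule shift_stable_exists[of ?Q G0 "X - {i, j}"])
      show "?Q G0"
        using G0 meet by simp
      fix H assume H: "?Q H"
      then show "finite H \<and> (\<forall>A\<in>H. finite A)"
        using finF by blast
      fix a b assume ab: "a \<in> X - {i, j}" "b \<in> X - {i, j}" "a < b"
      \<comment> \<open>By maximality, \<open>H\<close> contains every \<open>k\<close>-set through \<open>i\<close> and \<open>j\<close>; shifting fixes them,
        and they have no common element besides \<open>i\<close> and \<open>j\<close>.\<close>
      have full: "C \<in> H" if C: "C \<in> ksub X k" "{i, j} \<subseteq> C" for C
      proof (rule ccontr)
        assume "C \<notin> H"
        have "HM_family X k (insert C H)"
          using H C by (auto simp: HM_family_def intersecting_def nontrivial_def)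
        moreover have "card (insert C H) = Suc (card H)"
          using \<open>C \<notin> H\<close> finF H by auto
        ultimately show False
          using max[of "insert C H"] H by simp
      qed
      have full_shift: "C \<in> shift a b H ` H" if C: "C \<in> ksub X k" "{i, j} \<subseteq> C" for C
      proof -
        have "insert a (C - {b}) \<in> H" if "b \<in> C" "a \<notin> C"
        proof (rule full)
          have "finite C"
            using C less.prems(1) by (auto simp: ksub_def intro: finite_subset)
          then show "insert a (C - {b}) \<in> ksub X k"
            using C that ab card_Suc_Diff1[of C b] by (auto simp: ksub_def)
          show "{i, j} \<subseteq> insert a (C - {b})"
            using C ab by auto
        qed
        then have "shift a b H C = C"
          by (auto simp: shift_def)
        then show ?thesis
          using full[OF C] by (metis imageI)
      qed
      have "nontrivial (shift a b H ` H)"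
        unfolding nontrivial_def
      proof
        fix x
        show "\<exists>A\<in>shift a b H ` H. x \<notin> A"
        proof (cases "x \<in> {i, j}")
          case True
          obtain A where "A \<in> H" "x \<notin> A"
            using H unfolding HM_family_def nontrivial_def by blast
          then have "x \<notin> shift a b H A"
            using True ab by (auto simp: shift_def)
          then show ?thesis
            using \<open>A \<in> H\<close> by blast
        next
          case False
          have "card (X - {i, j, x}) \<ge> card X - 3"
            by (rule order.trans[OF _ diff_card_le_card_Diff]) (auto simp: card_insert_if)
          then have "k - 2 \<le> card (X - {i, j, x})"
            using less.prems(2) by linarith
          then obtain Z where Z: "Z \<subseteq> X - {i, j, x}" "card Z = k - 2" "finite Z"
            by (rule obtain_subset_with_card_n)
          have "card ({i, j} \<union> Z) = k"
            using Z ij k2 by (subst card_Un_disjoint) auto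
          then have "{i, j} \<union> Z \<in> shift a b H ` H"
            using Z ij by (intro full_shift) (auto simp: ksub_def)
          then show ?thesis
            using Z False by blast
        qed
      qed
      moreover have "\<forall>A\<in>shift a b H ` H. A \<inter> {i, j} \<noteq> {}"
        using H ab by (auto simp: shift_def)
      ultimately show "?Q (shift a b H ` H)"
        using H ab less.prems(1)
        by (simp add: HM_family_def card_shift intersecting_shift shift_in_ksub)
    qed blast
    show ?thesis
    proof (rule finish[of G "{i, j}"])
      fix A assume "A \<in> G"
      then have "A \<inter> {i, j} \<noteq> {}"
        using G(1) by blast
      then have "0 < card (A \<inter> {i, j})"
        by (simp add: card_gt_0_iff)
      moreover have "card {i, j} = 2"
        using ij(3) by simp
      ultimately show "card {i, j} \<le> 2 * card (A \<inter> {i, j})"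
        by linarith
    qed (use G ij in auto)
  qed
qed

text \<open>The Erdos-Ko-Rado bound: a nontrivial family is covered by Hilton--Milner, where the
  subtracted binomial is at least 1, and a trivial one lies in a star.\<close>

lemma card_intersecting_le:
  fixes X :: "nat set"
  assumes "finite X" "2 * k + 1 \<le> card X" "F \<subseteq> ksub X k" "intersecting F" "0 < k"
  shows "card F \<le> (card X - 1) choose (k - 1)"
proof (cases "nontrivial F")
  case True
  have "0 < (card X - k - 1) choose (k - 1)"
    using assms(2) by (intro zero_less_binomial) auto
  then show ?thesis
    using hilton_milner[of X k F] assms True unfolding HM_family_def by linarith
next
  case False
  then obtain x where x: "\<And>A. A \<in> F \<Longrightarrow> x \<in> A"
    by (auto simp: nontrivial_def)
  show ?thesis
  proof (cases "F = {}")
    case False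
    then have "x \<in> X"
      using x assms(3) by (auto simp: ksub_def)
    have "card F \<le> card {A \<in> ksub X k. x \<in> A}"
      using assms x by (intro card_mono) (auto simp: finite_ksub)
    then show ?thesis
      using card_star[OF assms(1) \<open>x \<in> X\<close> assms(5)] by simp
  qed auto
qed

section \<open>Fragments of a finite graph\<close>

locale fin_graph =
  fixes V :: "'v set" and adj :: "'v \<Rightarrow> 'v \<Rightarrow> bool"
  assumes finite_V: "finite V" and adj_sym: "adj x y \<Longrightarrow> adj y x"
begin

definition bd :: "'v set \<Rightarrow> 'v set" where
  "bd F = {y \<in> V - F. \<exists>x\<in>F. adj x y}"

definition ext :: "'v set \<Rightarrow> 'v set" where
  "ext F = V - F - bd F"

text \<open>For \<open>t = 1\<close> the boundary is a separating set; \<open>t = 2\<close> also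
  excludes cutting off a single vertex.\<close>

definition fragment :: "nat \<Rightarrow> 'v set \<Rightarrow> bool" where
  "fragment t F \<longleftrightarrow> F \<subseteq> V \<and> t \<le> card F \<and> t \<le> card (ext F)"

text \<open>An atom of connectivity theory. The tie-break by size makes uncrossing yield equality of
  sets.\<close>

definition tight :: "nat \<Rightarrow> 'v set \<Rightarrow> bool" where
  "tight t P \<longleftrightarrow> fragment t P \<and> (\<forall>F. fragment t F \<longrightarrow>
    card (bd P) \<le> card (bd F) \<and> (card (bd F) = card (bd P) \<longrightarrow> card P \<le> card F))"

lemma finite_bd: "finite (bd F)"
  using finite_V by (auto simp: bd_def)

text \<open>A vertex in either boundary on the left lies in \<open>bd F\<close> or
  \<open>bd G\<close>, and a vertex in both lies in \<open>bd F\<close> and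
  \<open>bd G\<close>.\<close>

lemma bd_submodular:
  assumes "F \<subseteq> V" "G \<subseteq> V"
  shows "card (bd (F \<inter> G)) + card (bd (F \<union> G)) \<le> card (bd F) + card (bd G)"
proof -
  have "card (bd (F \<inter> G)) + card (bd (F \<union> G))
      = card (bd (F \<inter> G) \<union> bd (F \<union> G)) + card (bd (F \<inter> G) \<inter> bd (F \<union> G))"
    by (rule card_Un_Int[OF finite_bd finite_bd])
  also have "\<dots> \<le> card (bd F \<union> bd G) + card (bd F \<inter> bd G)"
    by (intro add_mono card_mono) (auto simp: finite_bd, auto simp: bd_def)
  also have "\<dots> = card (bd F) + card (bd G)"
    by (rule card_Un_Int[OF finite_bd finite_bd, symmetric])
  finally show ?thesis .
qed

lemma card_split:
  assumes "F \<subseteq> V"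
  shows "card F + card (bd F) + card (ext F) = card V"
proof -
  have "finite F" "finite (ext F)"
    using assms finite_V by (auto simp: ext_def intro: finite_subset)
  then have "card F + card (bd F) + card (ext F) = card (F \<union> bd F \<union> ext F)"
    using finite_bd[of F] by (subst card_Un_disjoint, simp, simp, force simp: ext_def)
      (subst card_Un_disjoint, auto simp: bd_def)
  also have "F \<union> bd F \<union> ext F = V"
    using assms by (auto simp: ext_def bd_def)
  finally show ?thesis .
qed

lemma bd_ext: "bd (ext F) \<subseteq> bd F"
  using adj_sym by (auto simp: bd_def ext_def)

lemma subset_ext_ext: "F \<subseteq> V \<Longrightarrow> F \<subseteq> ext (ext F)"
  using adj_sym by (auto simp: bd_def ext_def)

lemma ext_antimono: "F \<subseteq> G \<Longrightarrow> ext G \<subseteq> ext F"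
  by (auto simp: bd_def ext_def)

lemma fragment_ext:
  assumes "fragment t F"
  shows "fragment t (ext F)"
proof -
  have "card F \<le> card (ext (ext F))"
    using assms finite_V by (intro card_mono subset_ext_ext) (auto simp: fragment_def ext_def)
  then show ?thesis
    using assms by (auto simp: fragment_def ext_def)
qed

lemma tight_exists:
  assumes "fragment t F"
  obtains P where "tight t P"
proof -
  obtain G where G: "fragment t G" "\<And>H. fragment t H \<Longrightarrow> card (bd G) \<le> card (bd H)"
    using ex_has_least_nat[of "fragment t" F "\<lambda>F. card (bd F)"] assms by blast
  obtain P where P: "fragment t P" "card (bd P) = card (bd G)"
    "\<And>H. fragment t H \<Longrightarrow> card (bd H) = card (bd G) \<Longrightarrow> card P \<le> card H"
    using ex_has_least_nat[of "\<lambda>H. fragment t H \<and> card (bd H) = card (bd G)" G card] G(1) by blast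
  then have "tight t P"
    using G(2) by (auto simp: tight_def)
  then show thesis
    by (rule that)
qed

lemma bd_image:
  assumes "bij_betw f V V" "\<And>x y. x \<in> V \<Longrightarrow> y \<in> V \<Longrightarrow> adj (f x) (f y) \<longleftrightarrow> adj x y" "F \<subseteq> V"
  shows "bd (f ` F) = f ` bd F"
proof -
  have f: "f ` V = V" "inj_on f V"
    using assms(1) by (auto simp: bij_betw_def)
  have "y \<in> bd (f ` F) \<longleftrightarrow> y \<in> f ` bd F" if "y \<in> V" for y
  proof -
    have "y \<in> f ` V"
      using f(1) that by simp
    then obtain z where z: "z \<in> V" "y = f z"
      by blast
    have mem: "f z \<in> f ` G \<longleftrightarrow> z \<in> G" if "G \<subseteq> V" for G
      using inj_on_image_mem_iff[OF f(2) z(1) that] .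
    have "bd F \<subseteq> V"
      by (auto simp: bd_def)
    have "f z \<in> bd (f ` F) \<longleftrightarrow> z \<notin> F \<and> (\<exists>x\<in>F. adj (f x) (f z))"
      unfolding bd_def using that z mem[OF assms(3)] by simp
    also have "\<dots> \<longleftrightarrow> z \<notin> F \<and> (\<exists>x\<in>F. adj x z)"
      using assms(2)[OF _ z(1)] assms(3) by blast
    also have "\<dots> \<longleftrightarrow> f z \<in> f ` bd F"
      unfolding mem[OF \<open>bd F \<subseteq> V\<close>] using z(1) by (simp add: bd_def)
    finally show ?thesis
      using z(2) by simp
  qed
  moreover have "bd (f ` F) \<subseteq> V" "f ` bd F \<subseteq> V"
    using f(1) by (auto simp: bd_def)
  ultimately show ?thesis
    by blast
qed

text \<open>Both the intersection and the union of \<open>P\<close> with its image are fragments, so submodularity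
  makes the intersection another minimizer of \<open>card (bd _)\<close>.\<close>

lemma tight_automorphism:
  assumes "tight t P" "bij_betw f V V"
    and hom: "\<And>x y. x \<in> V \<Longrightarrow> y \<in> V \<Longrightarrow> adj (f x) (f y) \<longleftrightarrow> adj x y"
    and meet: "t \<le> card (P \<inter> f ` P)"
  shows "f ` P = P"
proof -
  have P: "P \<subseteq> V" "t \<le> card P" "t \<le> card (ext P)"
    using assms(1) by (auto simp: tight_def fragment_def)
  have bd_min: "card (bd P) \<le> card (bd F)" if "fragment t F" for F
    using assms(1) that by (auto simp: tight_def)
  have card_min: "card P \<le> card F" if "fragment t F" "card (bd F) \<le> card (bd P)" for F
    using assms(1) that le_antisym[of "card (bd F)" "card (bd P)"] by (auto simp: tight_def)
  define Q where "Q = f ` P"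
  have f: "f ` V = V" "inj_on f V"
    using assms(2) by (auto simp: bij_betw_def)
  have QV: "Q \<subseteq> V"
    using P f by (auto simp: Q_def)
  have fin: "finite P" "finite Q"
    using P QV finite_V finite_subset by auto
  have cardQ: "card Q = card P"
    unfolding Q_def using f(2) P(1) by (intro card_image) (rule inj_on_subset)
  have "bd P \<subseteq> V"
    by (auto simp: bd_def)
  then have "card (f ` bd P) = card (bd P)"
    using f(2) by (intro card_image) (rule inj_on_subset)
  moreover have "bd Q = f ` bd P"
    unfolding Q_def using assms(2) hom P(1) by (rule bd_image)
  ultimately have bdQ: "card (bd Q) = card (bd P)"
    by simp
  \<comment> \<open>\<open>ext P\<close> is a fragment with no larger boundary, so \<open>P\<close>
    is no larger than its exterior.\<close>
  have "card (bd (ext P)) \<le> card (bd P)"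
    by (intro card_mono finite_bd bd_ext)
  then have "card P \<le> card (ext P)"
    using fragment_ext card_min assms(1) by (auto simp: tight_def)
  have "card (ext P) \<le> card (ext (P \<inter> Q))"
    using finite_V by (intro card_mono ext_antimono) (auto simp: ext_def)
  then have frag: "fragment t (P \<inter> Q)"
    using P meet by (auto simp: fragment_def Q_def)
  have sub: "card (bd (P \<inter> Q)) + card (bd (P \<union> Q)) \<le> card (bd P) + card (bd P)"
    using bd_submodular[OF P(1) QV] bdQ by simp
  then have "card (bd (P \<union> Q)) \<le> card (bd P)"
    using bd_min[OF frag] by linarith
  moreover have "card (P \<union> Q) + card (P \<inter> Q) = card P + card P"
    using card_Un_Int[OF fin] cardQ by simp
  moreover have "card (P \<union> Q) + card (bd (P \<union> Q)) + card (ext (P \<union> Q)) = card V"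
    using P QV by (intro card_split) auto
  moreover have "card P + card (bd P) + card (ext P) = card V"
    using P by (intro card_split)
  \<comment> \<open>The union has at most \<open>2 * card P - t\<close> elements and a boundary no
    larger than \<open>bd P\<close>, so its exterior has at least
    \<open>card (ext P) - card P + t\<close> elements.\<close>
  ultimately have "t \<le> card (ext (P \<union> Q))"
    using \<open>card P \<le> card (ext P)\<close> meet unfolding Q_def by linarith
  moreover have "t \<le> card (P \<union> Q)"
    using P(2) fin by (meson card_mono finite_UnI Un_upper1 order_trans)
  ultimately have "fragment t (P \<union> Q)"
    using P QV by (auto simp: fragment_def)
  then have "card (bd (P \<inter> Q)) \<le> card (bd P)"
    using bd_min sub by fastforce
  then have "card P \<le> card (P \<inter> Q)"
    using card_min frag by blast
  then have "P \<inter> Q = P"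
    using fin by (intro card_seteq) auto
  then have "P \<subseteq> Q"
    by blast
  then show ?thesis
    using card_subset_eq[OF fin(2), of P] cardQ by (simp add: Q_def)
qed

end

section \<open>Vertex connectivity of Kneser graphs\<close>

lemma card_exchange: "finite A \<Longrightarrow> a \<in> A \<Longrightarrow> y \<notin> A \<Longrightarrow> card (insert y (A - {a})) = card A"
  by (metis DiffD1 card_Suc_Diff1 card_insert_disjoint finite_Diff)

lemma inj_on_exchange: "inj_on (\<lambda>(a, y). insert y (A - {a})) (A \<times> (X - A))"
proof (rule inj_onI, clarsimp)
  fix a y b z
  assume "a \<in> A" "b \<in> A" "y \<notin> A" "z \<notin> A" and eq: "insert y (A - {a}) = insert z (A - {b})"
  moreover have "y \<in> insert z (A - {b})" "a \<notin> insert z (A - {b})"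
    using calculation by (auto simp flip: eq)
  ultimately show "a = b \<and> y = z"
    by auto
qed

section \<open>Transpositions preserving a family\<close>

abbreviation swap :: "'a \<Rightarrow> 'a \<Rightarrow> 'a set \<Rightarrow> 'a set" where
  "swap a b A \<equiv> transpose a b ` A"

lemma swap_exchange:
  assumes "a \<in> A" "b \<notin> A"
  shows "swap a b A = insert b (A - {a})"
  using assms by (auto simp: in_transpose_image_iff transpose_def split: if_splits)

definition swappable :: "'a set set \<Rightarrow> 'a \<Rightarrow> 'a \<Rightarrow> bool" where
  "swappable P a b \<longleftrightarrow> swap a b ` P = P"

lemma swappable_refl: "swappable P a a"
  by (simp add: swappable_def)

lemma swappable_sym: "swappable P a b \<Longrightarrow> swappable P b a"
  by (simp add: swappable_def transpose_commute)

text \<open>Conjugating the transposition of \<open>b\<close>, \<open>c\<close> by that of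
  \<open>a\<close>, \<open>b\<close> gives that of \<open>a\<close>, \<open>c\<close>.\<close>

lemma swappable_trans:
  assumes "swappable P a b" "swappable P b c"
  shows "swappable P a c"
proof (cases "a = c \<or> b = c")
  case True
  then show ?thesis
    using assms swappable_refl by auto
next
  case False
  then have "transpose a b \<circ> transpose b c \<circ> transpose a b = transpose a c"
    by (intro transpose_comp_triple) auto
  then have "swap a b (swap b c (swap a b A)) = swap a c A" for A
    by (simp only: image_comp comp_assoc)
  then have "swap a c ` P = swap a b ` swap b c ` swap a b ` P"
    by (simp only: image_image)
  then show ?thesis
    using assms by (simp add: swappable_def)
qed

text \<open>Elements of \<open>A - B\<close> are exchanged one by one for elements of
  \<open>B - A\<close>, all inside \<open>U\<close>. Hence for sets of one size, membership in
  \<open>P\<close> depends only on the part off \<open>U\<close>.\<close>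

lemma swappable_class_closed:
  assumes sw: "\<And>x y. x \<in> U \<Longrightarrow> y \<in> U \<Longrightarrow> swappable P x y"
    and "finite A" "finite B" "card A = card B" "A - U = B - U" "A \<in> P"
  shows "B \<in> P"
  using assms(2-)
proof (induction "card (A - B)" arbitrary: A rule: less_induct)
  case less
  show ?case
  proof (cases "A \<subseteq> B")
    case True
    then show ?thesis
      using less.prems card_subset_eq by metis
  next
    case False
    then obtain a where a: "a \<in> A" "a \<notin> B"
      by blast
    have "\<not> B \<subseteq> A"
      using less.prems False card_subset_eq by metis
    then obtain b where b: "b \<in> B" "b \<notin> A"
      by blast
    define A' where "A' = insert b (A - {a})"
    have ab: "a \<in> U" "b \<in> U"
      using a b less.prems by blast+
    then have "A' \<in> P"
      using sw[OF ab] less.prems a b swap_exchange[of a A b]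
      unfolding swappable_def A'_def by (metis imageI)
    moreover have "card (A' - B) < card (A - B)"
      using a b less.prems by (intro psubset_card_mono) (auto simp: A'_def)
    moreover have "card A' = card B"
      unfolding A'_def using less.prems a b by (metis card_exchange)
    moreover have "A' - U = B - U"
      using less.prems ab by (auto simp: A'_def)
    ultimately show ?thesis
      using less.hyps[of A'] less.prems by (simp add: A'_def)
  qed
qed

section \<open>Neighbourhoods and tight fragments in Kneser graphs\<close>

locale kneser =
  fixes n k :: nat
  assumes k_ge: "3 \<le> k" and n_ge: "2 * k + 1 \<le> n"
begin

abbreviation V :: "nat set set" where
  "V \<equiv> kneser_verts n k"

lemma V_eq: "V = ksub {1..n} k"
  by (simp add: kneser_verts_def ksub_def)

lemma V_iff: "A \<in> V \<longleftrightarrow> A \<subseteq> {1..n} \<and> card A = k"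
  by (simp add: kneser_verts_def)

lemma finite_vertex: "A \<in> V \<Longrightarrow> finite A"
  using finite_subset by (auto simp: V_iff)

sublocale fin_graph "kneser_verts n k" "\<lambda>A B. A \<inter> B = {}"
  by unfold_locales (auto simp: V_eq finite_ksub)

definition nbh :: "nat set \<Rightarrow> nat set set" where
  "nbh A = {B \<in> V. A \<inter> B = {}}"

abbreviation d :: nat where
  "d \<equiv> (n - k) choose k"

lemma finite_nbh: "finite (nbh A)"
  using finite_V by (simp add: nbh_def)

lemma card_nbh:
  assumes "A \<in> V"
  shows "card (nbh A) = d"
proof -
  have "nbh A = ksub ({1..n} - A) k"
    by (auto simp: nbh_def V_iff ksub_def)
  then show ?thesis
    using assms finite_vertex by (simp add: card_ksub card_Diff_subset V_iff)
qed

text \<open>A point \<open>b\<close> of \<open>B\<close> outside \<open>A\<close> extends to a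
  \<open>k\<close>-set avoiding \<open>A\<close>: a neighbour of \<open>A\<close> but not of
  \<open>B\<close>.\<close>

lemma nbh_inject:
  assumes "A \<in> V" "B \<in> V" "nbh A = nbh B"
  shows "A = B"
proof (rule ccontr)
  assume "A \<noteq> B"
  then have "\<not> B \<subseteq> A"
    using assms finite_vertex card_subset_eq by (metis V_iff)
  then obtain b where b: "b \<in> B" "b \<notin> A"
    by blast
  have bn: "b \<in> {1..n} - A"
    using assms(2) b unfolding V_iff by blast
  have "card ({1..n} - A) = n - k"
    using assms(1) finite_vertex by (simp add: card_Diff_subset V_iff)
  then have "k - 1 \<le> card ({1..n} - A - {b})"
    using bn n_ge by simp
  then obtain Z where Z: "Z \<subseteq> {1..n} - A - {b}" "card Z = k - 1" "finite Z"
    by (rule obtain_subset_with_card_n)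
  then have "insert b Z \<in> nbh A"
    using bn assms(1) k_ge unfolding nbh_def V_iff by (auto simp: card_insert_if)
  moreover have "insert b Z \<notin> nbh B"
    using b by (auto simp: nbh_def)
  ultimately show False
    using assms(3) by simp
qed

lemma swap_in_V:
  assumes "a \<in> {1..n}" "b \<in> {1..n}" "A \<in> V"
  shows "swap a b A \<in> V"
proof -
  have "swap a b A \<subseteq> swap a b {1..n}"
    using assms(3) by (intro image_mono) (auto simp: V_iff)
  also have "\<dots> = {1..n}"
    using assms by (intro transpose_image_eq) simp
  finally show ?thesis
    using assms by (simp add: V_iff card_image)
qed

lemma tight_swappable:
  assumes "tight t P" "a \<in> {1..n}" "b \<in> {1..n}" "t \<le> card (P \<inter> swap a b ` P)"
  shows "swappable P a b"
  unfolding swappable_def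
proof (rule tight_automorphism[OF assms(1) _ _ assms(4)])
  have "swap a b ` V \<subseteq> V"
    using swap_in_V assms by blast
  then show "bij_betw (swap a b) V V"
    by (intro bij_betw_byWitness[where f' = "swap a b"]) (simp_all add: image_comp)
  show "swap a b A \<inter> swap a b B = {} \<longleftrightarrow> A \<inter> B = {}" for A B
    by (simp add: image_Int[symmetric] inj_transpose)
qed

text \<open>Otherwise \<open>P\<close> would contain every vertex and have empty exterior.\<close>

lemma not_all_swappable:
  assumes "tight t P" "0 < t"
  shows "\<not> (\<forall>x\<in>{1..n}. \<forall>y\<in>{1..n}. swappable P x y)"
proof
  assume sw: "\<forall>x\<in>{1..n}. \<forall>y\<in>{1..n}. swappable P x y"
  have P: "P \<subseteq> V" "t \<le> card P" "t \<le> card (ext P)"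
    using assms by (auto simp: tight_def fragment_def)
  then have "P \<noteq> {}"
    using assms(2) by auto
  then obtain A where A: "A \<in> P" "A \<in> V"
    using P(1) by blast
  have "B \<in> P" if "B \<in> V" for B
  proof (rule swappable_class_closed[of "{1..n}" P A])
    show "swappable P x y" if "x \<in> {1..n}" "y \<in> {1..n}" for x y
      using sw that by blast
    show "A - {1..n} = B - {1..n}" "card A = card B"
      using A(2) that unfolding V_iff by (blast, simp)
    show "finite A" "finite B" "A \<in> P"
      using A that finite_vertex by blast+
  qed
  then have "ext P = {}"
    by (auto simp: ext_def)
  then show False
    using P assms(2) by simp
qed

lemma all_swappable_via:
  assumes "\<And>x. x \<in> {1..n} \<Longrightarrow> swappable P x z"
  shows "\<forall>x\<in>{1..n}. \<forall>y\<in>{1..n}. swappable P x y"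
  using swappable_trans[OF assms swappable_sym[OF assms]] by blast

lemma exists_outside:
  assumes "A \<in> V" "B \<in> V"
  obtains z where "z \<in> {1..n}" "z \<notin> A" "z \<notin> B"
proof -
  have "card (A \<union> B) \<le> card A + card B"
    by (rule card_Un_le)
  also have "\<dots> < card {1..n}"
    using assms n_ge by (simp add: V_iff)
  finally have "\<not> {1..n} \<subseteq> A \<union> B"
    using assms finite_vertex card_mono by (metis finite_UnI not_less)
  then show thesis
    using that by blast
qed

text \<open>A transposition that does not separate points of a member \<open>C\<close> fixes
  \<open>C\<close>, hence \<open>P\<close> by \<open>tight_swappable\<close>. Two distinct members
  would make all points swappable, so a tight \<open>P\<close> is a single vertex and its boundary
  is a neighbourhood.\<close>

theorem card_bd_ge:
  assumes "fragment 1 F"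
  shows "d \<le> card (bd F)"
proof -
  obtain P where P: "tight 1 P"
    using tight_exists[OF assms] .
  then have PV: "P \<subseteq> V" "1 \<le> card P"
    by (auto simp: tight_def fragment_def)
  then obtain A where A: "A \<in> P"
    by fastforce
  have fixed: "swappable P x y" if "C \<in> P" "x \<in> {1..n}" "y \<in> {1..n}" "x \<in> C \<longleftrightarrow> y \<in> C" for C x y
  proof (rule tight_swappable[OF P that(2,3)])
    have "C \<in> P \<inter> swap x y ` P"
      using that transpose_image_eq by (metis IntI imageI)
    then show "1 \<le> card (P \<inter> swap x y ` P)"
      using PV(1) finite_V finite_subset by (metis Suc_leI One_nat_def card_gt_0_iff empty_iff finite_Int)
  qed
  have "B = A" if B: "B \<in> P" for B
  proof (rule ccontr)
    assume "B \<noteq> A"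
    then have "\<not> A \<subseteq> B"
      using A B PV(1) finite_vertex card_subset_eq V_iff by (metis subsetD)
    then obtain y where y: "y \<in> A" "y \<notin> B"
      by blast
    then have yn: "y \<in> {1..n}"
      using A PV(1) V_iff by blast
    obtain z where z: "z \<in> {1..n}" "z \<notin> A" "z \<notin> B"
      using exists_outside A B PV(1) by blast
    have "swappable P x z" if "x \<in> {1..n}" for x
    proof (cases "x \<in> A \<and> x \<in> B")
      case True
      then have "swappable P x y" "swappable P y z"
        using fixed[OF A that yn] fixed[OF B yn z(1)] y z by auto
      then show ?thesis
        by (rule swappable_trans)
    next
      case False
      then show ?thesis
        using fixed[OF A that z(1)] fixed[OF B that z(1)] z by auto
    qed
    then show False
      using not_all_swappable[OF P zero_less_one] all_swappable_via[of P z] by blast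
  qed
  then have "P = {A}"
    using A by blast
  moreover have "A \<noteq> {}"
    using A PV(1) k_ge by (auto simp: V_iff)
  ultimately have "bd P = nbh A"
    by (auto simp: bd_def nbh_def)
  then have "card (bd P) = d"
    using A PV(1) card_nbh by auto
  then show ?thesis
    using P assms by (auto simp: tight_def)
qed

text \<open>For \<open>t = 2\<close> a transposition must respect two distinct members. The pair
  \<open>A\<close>, \<open>B\<close> leaves two classes outside \<open>A\<close>, namely
  \<open>B\<close> and the remainder; a third member either merges them or separates them
  completely.\<close>

lemma tight_dichotomy:
  assumes P: "tight 2 P" and AB: "A \<in> P" "B \<in> P" "A \<inter> B = {}"
  shows "(\<forall>x\<in>{1..n} - A. \<forall>y\<in>{1..n} - A. swappable P x y) \<or>
    (\<forall>C\<in>P. C \<noteq> A \<longrightarrow> C = B \<or> ({1..n} - A - B \<subseteq> C \<and> C \<inter> B = {}))"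
proof (rule disjCI)
  have PV: "P \<subseteq> V" "finite P"
    using P finite_V finite_subset by (auto simp: tight_def fragment_def)
  have fixed: "swappable P x y" if "C \<in> P" "D \<in> P" "C \<noteq> D" "x \<in> {1..n}" "y \<in> {1..n}"
    "x \<in> C \<longleftrightarrow> y \<in> C" "x \<in> D \<longleftrightarrow> y \<in> D" for C D x y
  proof (rule tight_swappable[OF P that(4,5)])
    have "{C, D} \<subseteq> P \<inter> swap x y ` P"
      using that(1,2) imageI[OF that(1), of "swap x y"] imageI[OF that(2), of "swap x y"]
        transpose_image_eq[OF that(6)] transpose_image_eq[OF that(7)] by simp
    then have "card {C, D} \<le> card (P \<inter> swap x y ` P)"
      using PV(2) by (intro card_mono) auto
    then show "2 \<le> card (P \<inter> swap x y ` P)"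
      using that(3) by simp
  qed
  have AV: "A \<in> V" "B \<in> V"
    using AB PV by auto
  have ne: "A \<noteq> B"
    using AB AV k_ge by (auto simp: V_iff)
  have Bn: "B \<subseteq> {1..n}"
    using AV by (simp add: V_iff)
  assume "\<not> (\<forall>C\<in>P. C \<noteq> A \<longrightarrow> C = B \<or> ({1..n} - A - B \<subseteq> C \<and> C \<inter> B = {}))"
  then obtain C where C: "C \<in> P" "C \<noteq> A" "C \<noteq> B"
    "\<not> ({1..n} - A - B \<subseteq> C \<and> C \<inter> B = {})"
    by blast
  have "\<exists>b\<in>B. \<exists>r\<in>{1..n} - A - B. b \<in> C \<longleftrightarrow> r \<in> C"
  proof (cases "{1..n} - A - B \<subseteq> C")
    case True
    then obtain b where "b \<in> B" "b \<in> C"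
      using C(4) by blast
    moreover obtain r where "r \<in> {1..n}" "r \<notin> A" "r \<notin> B"
      using exists_outside[OF AV] .
    ultimately show ?thesis
      using True by blast
  next
    case False
    then obtain r where r: "r \<in> {1..n} - A - B" "r \<notin> C"
      by blast
    have "C \<in> V"
      using C(1) PV by blast
    then have "\<not> B \<subseteq> C"
      using AV(2) C(3) finite_vertex card_subset_eq by (metis V_iff)
    then show ?thesis
      using r by blast
  qed
  then obtain b r where br: "b \<in> B" "r \<in> {1..n} - A - B" "b \<in> C \<longleftrightarrow> r \<in> C"
    by blast
  have bn: "b \<in> {1..n}" "b \<notin> A" "r \<in> {1..n}" "r \<notin> A" "r \<notin> B"
    using br Bn AB(3) by auto
  have b_r: "swappable P b r"
    using fixed[OF AB(1) C(1), of b r] C(2) bn br(3) by auto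
  have via_r: "swappable P x r" if x: "x \<in> {1..n} - A" for x
  proof (cases "x \<in> B")
    case True
    then have "swappable P x b"
      using fixed[OF AB(1,2) ne, of x b] x bn br(1) by auto
    then show ?thesis
      using b_r by (rule swappable_trans)
  next
    case False
    then show ?thesis
      using fixed[OF AB(1,2) ne, of x r] x bn by auto
  qed
  show "\<forall>x\<in>{1..n} - A. \<forall>y\<in>{1..n} - A. swappable P x y"
    using swappable_trans[OF via_r swappable_sym[OF via_r]] by blast
qed

lemma exchange_in_V:
  assumes "A \<in> V" "a \<in> A" "y \<in> {1..n}" "y \<notin> A"
  shows "insert y (A - {a}) \<in> V" "insert y (A - {a}) \<inter> A \<noteq> {}"
proof -
  show "insert y (A - {a}) \<in> V"
    using assms card_exchange[of A a y] finite_vertex unfolding V_iff by auto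
  have "card (A - {a}) \<noteq> 0"
    using assms k_ge by (simp add: V_iff)
  then show "insert y (A - {a}) \<inter> A \<noteq> {}"
    by (auto simp: card_eq_0_iff)
qed

text \<open>Swappability off \<open>A\<close> puts all of \<open>nbh A\<close> into
  \<open>P\<close>, and \<open>few\<close> then forces \<open>n = 2 * k + 1\<close>. Now all
  one-point exchanges of \<open>A\<close> are boundary vertices; there are
  \<open>k * (k + 1)\<close> of them, while \<open>d = k + 1\<close>.\<close>

lemma tight_star_contradiction:
  assumes P: "tight 2 P" and AB: "A \<in> P" "B \<in> P" "A \<inter> B = {}" and bdP: "card (bd P) = d"
    and sw: "\<forall>x\<in>{1..n} - A. \<forall>y\<in>{1..n} - A. swappable P x y"
    and few: "\<forall>C\<in>P. C \<noteq> B \<longrightarrow> C = A \<or> ({1..n} - B - A \<subseteq> C \<and> C \<inter> A = {})"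
  shows False
proof -
  have PV: "P \<subseteq> V"
    using P by (auto simp: tight_def fragment_def)
  have AV: "A \<in> V" "B \<in> V"
    using AB PV by auto
  have sub: "A \<subseteq> {1..n}" "B \<subseteq> {1..n}" "card A = k" "card B = k" "finite A" "finite B"
    using AV finite_vertex by (auto simp: V_iff)
  have nbh_P: "C \<in> P" if "C \<in> nbh A" for C
  proof (rule swappable_class_closed[of "{1..n} - A" P B])
    show "swappable P x y" if "x \<in> {1..n} - A" "y \<in> {1..n} - A" for x y
      using sw that by blast
    have C: "C \<in> V" "A \<inter> C = {}"
      using that by (auto simp: nbh_def)
    then show "finite C" "card B = card C"
      using finite_vertex AV by (auto simp: V_iff)
    have "C \<subseteq> {1..n}"
      using C by (simp add: V_iff)
    then show "B - ({1..n} - A) = C - ({1..n} - A)"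
      using C(2) AB(3) sub(2) by blast
  qed (use sub AB in auto)
  let ?R = "{1..n} - B - A"
  have "card ?R = n - k - k"
    using sub AB(3) by (subst card_Diff_subset) (auto simp: card_Diff_subset)
  have "card ?R \<le> 1"
  proof (rule ccontr)
    assume "\<not> card ?R \<le> 1"
    then obtain r r' where r: "r \<in> ?R" "r' \<in> ?R" "r \<noteq> r'"
      by (metis card_le_Suc0_iff_eq One_nat_def finite_Diff finite_atLeastAtMost)
    obtain b where b: "b \<in> B"
      using sub k_ge by fastforce
    \<comment> \<open>This neighbour of \<open>A\<close> omits \<open>r\<close>, against
      \<open>few\<close>.\<close>
    have "insert r' (B - {b}) \<in> nbh A"
      using exchange_in_V(1)[OF AV(2) b, of r'] r AB(3) by (auto simp: nbh_def)
    then have "insert r' (B - {b}) \<in> P"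
      by (rule nbh_P)
    moreover have "insert r' (B - {b}) \<noteq> B" "insert r' (B - {b}) \<noteq> A"
      using r by auto
    ultimately have "?R \<subseteq> insert r' (B - {b})"
      using bspec[OF few, of "insert r' (B - {b})"] by simp
    then have "r \<in> insert r' (B - {b})"
      using r(1) by (rule subsetD)
    then show False
      using r by auto
  qed
  then have n_eq: "n = 2 * k + 1"
    using \<open>card ?R = n - k - k\<close> n_ge by linarith
  have "(\<lambda>(a, y). insert y (A - {a})) ` (A \<times> ({1..n} - A)) \<subseteq> bd P"
  proof (rule image_subsetI, clarify)
    fix a y assume a: "a \<in> A" and y: "y \<in> {1..n}" "y \<notin> A"
    let ?X = "insert y (A - {a})" and ?C = "{1..n} - A - {y}"
    have X: "?X \<in> V" "?X \<inter> A \<noteq> {}"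
      using exchange_in_V[OF AV(1) a y] .
    have "card ({1..n} - A) = n - k"
      using sub by (simp add: card_Diff_subset)
    then have "card ?C = k"
      using y n_eq by simp
    then have "?C \<in> nbh A"
      by (auto simp: nbh_def V_iff)
    then have "?C \<in> P"
      by (rule nbh_P)
    moreover have "?C \<inter> ?X = {}"
      by blast
    moreover have "?X \<notin> P"
    proof
      assume "?X \<in> P"
      moreover have "?X \<noteq> B"
        using X(2) AB(3) by blast
      ultimately have "?X = A \<or> ?X \<inter> A = {}"
        using bspec[OF few, of ?X] by satx
      then show False
        using X(2) y by blast
    qed
    ultimately show "?X \<in> bd P"
      using X(1) unfolding bd_def by blast
  qed
  then have "card ((\<lambda>(a, y). insert y (A - {a})) ` (A \<times> ({1..n} - A))) \<le> card (bd P)"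
    by (intro card_mono finite_bd)
  then have "k * (n - k) \<le> d"
    using bdP sub by (simp add: card_image[OF inj_on_exchange] card_cartesian_product card_Diff_subset)
  moreover have "d = k + 1"
    using n_eq by simp
  moreover have "3 * (k + 1) \<le> k * (k + 1)"
    using k_ge by (intro mult_right_mono) auto
  ultimately show False
    using n_eq by simp
qed

text \<open>Neighbours of \<open>A\<close> other than \<open>B\<close> and the remainder give at
  least \<open>d - 2\<close> boundary vertices. Replacing one element of \<open>A\<close> by a fixed
  \<open>r\<close> outside \<open>A\<close> and \<open>B\<close> gives \<open>k\<close> more,
  adjacent to \<open>B\<close>; since \<open>k \<ge> 3\<close>, the total exceeds
  \<open>d\<close>.\<close>

lemma tight_edge_contradiction:
  assumes P: "tight 2 P" and AB: "A \<in> P" "B \<in> P" "A \<inter> B = {}" and bdP: "card (bd P) = d"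
    and "P \<subseteq> {A, B, {1..n} - A - B}"
  shows False
proof -
  have PV: "P \<subseteq> V"
    using P by (auto simp: tight_def fragment_def)
  have AV: "A \<in> V" "B \<in> V"
    using AB PV by auto
  obtain r where r: "r \<in> {1..n}" "r \<notin> A" "r \<notin> B"
    using exists_outside[OF AV] .
  let ?R = "{1..n} - A - B"
  let ?N = "nbh A - {B, ?R}" and ?M = "(\<lambda>a. insert r (A - {a})) ` A"
  have "?M = (\<lambda>(a, y). insert y (A - {a})) ` (A \<times> {r})"
    by auto
  moreover have "inj_on (\<lambda>(a, y). insert y (A - {a})) (A \<times> {r})"
    using r by (intro inj_on_subset[OF inj_on_exchange[of A "{r} \<union> A"]]) auto
  ultimately have cardM: "card ?M = k"
    using AV by (simp add: card_image card_cartesian_product V_iff)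
  have "card (nbh A) - card {B, ?R} \<le> card ?N"
    by (rule diff_card_le_card_Diff) simp
  moreover have "card {B, ?R} \<le> 2"
    by (simp add: card_insert_if)
  ultimately have cardN: "d - 2 \<le> card ?N"
    using card_nbh[OF AV(1)] by linarith
  have M: "X \<in> V \<and> X \<inter> A \<noteq> {}" if "X \<in> ?M" for X
    using that exchange_in_V[OF AV(1) _ r(1,2)] by blast
  have "?N \<inter> ?M = {}"
    using M by (auto simp: nbh_def)
  moreover have "finite ?M" "finite ?N"
    using finite_vertex[OF AV(1)] finite_nbh by auto
  ultimately have "card ?N + card ?M = card (?N \<union> ?M)"
    by (simp add: card_Un_disjoint)
  also have "\<dots> \<le> card (bd P)"
  proof (intro card_mono finite_bd Un_least subsetI)
    fix X assume X: "X \<in> ?N"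
    have "A \<noteq> {}"
      using AV k_ge by (auto simp: V_iff)
    then have "X \<noteq> A"
      using X by (auto simp: nbh_def)
    then have "X \<notin> P"
      using X assms(6) by blast
    then show "X \<in> bd P"
      using X AB(1) unfolding bd_def nbh_def by blast
  next
    fix X assume X: "X \<in> ?M"
    then have "X \<inter> B = {}" "r \<in> X"
      using AB(3) r by auto
    moreover have "X \<noteq> A" "X \<noteq> B" "X \<noteq> ?R"
      using M[OF X] AB(3) \<open>r \<in> X\<close> r by auto
    ultimately show "X \<in> bd P"
      using M[OF X] AB(2) assms(6) unfolding bd_def by blast
  qed
  finally show False
    using cardM cardN bdP k_ge by linarith
qed

text \<open>If the boundary had size \<open>d\<close>, an edgeless \<open>P\<close> would give all
  its members the same neighbourhood \<open>bd P\<close>. So \<open>P\<close> contains an edge, and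
  the dichotomy is applied from both of its ends.\<close>

theorem card_bd_gt:
  assumes "fragment 2 F"
  shows "d < card (bd F)"
proof (rule ccontr)
  assume "\<not> d < card (bd F)"
  obtain P where P: "tight 2 P"
    using tight_exists[OF assms] .
  then have PV: "P \<subseteq> V" "2 \<le> card P" "fragment 1 P"
    by (auto simp: tight_def fragment_def)
  have bdP: "card (bd P) = d"
  proof (rule antisym)
    have "card (bd P) \<le> card (bd F)"
      using P assms by (auto simp: tight_def)
    then show "card (bd P) \<le> d"
      using \<open>\<not> d < card (bd F)\<close> by simp
    show "d \<le> card (bd P)"
      using card_bd_ge[OF PV(3)] .
  qed
  have "\<exists>A\<in>P. \<exists>B\<in>P. A \<inter> B = {}"
  proof (rule ccontr)
    assume no_edge: "\<not> (\<exists>A\<in>P. \<exists>B\<in>P. A \<inter> B = {})"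
    have nbh_eq: "nbh A = bd P" if "A \<in> P" for A
    proof (rule card_subset_eq[OF finite_bd])
      show "nbh A \<subseteq> bd P"
        using no_edge that unfolding nbh_def bd_def by blast
      show "card (nbh A) = card (bd P)"
        using that PV(1) card_nbh bdP by auto
    qed
    have "finite P"
      using PV(1) finite_V finite_subset by blast
    then obtain A B where "A \<in> P" "B \<in> P" "A \<noteq> B"
      using PV(2) card_le_Suc0_iff_eq[of P] by fastforce
    then show False
      using nbh_inject[of A B] nbh_eq PV(1) by auto
  qed
  then obtain A B where AB: "A \<in> P" "B \<in> P" "A \<inter> B = {}"
    by blast
  then have BA: "B \<inter> A = {}"
    by blast
  have AV: "A \<in> V" "B \<in> V"
    using AB PV by auto
  obtain r where r: "r \<in> {1..n}" "r \<notin> A" "r \<notin> B"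
    using exists_outside[OF AV] .
  let ?sw = "\<lambda>A. \<forall>x\<in>{1..n} - A. \<forall>y\<in>{1..n} - A. swappable P x y"
  have few_AB: "\<forall>C\<in>P. C \<noteq> A \<longrightarrow> C = B \<or> ({1..n} - A - B \<subseteq> C \<and> C \<inter> B = {})" if "\<not> ?sw A"
    using tight_dichotomy[OF P AB] that by blast
  have few_BA: "\<forall>C\<in>P. C \<noteq> B \<longrightarrow> C = A \<or> ({1..n} - B - A \<subseteq> C \<and> C \<inter> A = {})" if "\<not> ?sw B"
    using tight_dichotomy[OF P AB(2,1) BA] that by blast
  consider "?sw A" "?sw B" | "?sw A" "\<not> ?sw B" | "\<not> ?sw A" "?sw B" | "\<not> ?sw A" "\<not> ?sw B"
    by blast
  then show False
  proof cases
    case 1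
    have "swappable P x r" if "x \<in> {1..n}" for x
      using 1(1)[rule_format, of x r] 1(2)[rule_format, of x r] r that AB(3) by blast
    then show False
      using not_all_swappable[OF P zero_less_numeral] all_swappable_via[of P r] by blast
  next
    case 2
    show False
      by (rule tight_star_contradiction[OF P AB bdP 2(1) few_BA[OF 2(2)]])
  next
    case 3
    show False
      by (rule tight_star_contradiction[OF P AB(2,1) BA bdP 3(2) few_AB[OF 3(1)]])
  next
    case 4
    have "C = {1..n} - A - B" if "C \<in> P" "C \<noteq> A" "C \<noteq> B" for C
    proof -
      have "C \<subseteq> {1..n}"
        using that(1) PV(1) V_iff by blast
      moreover have "{1..n} - A - B \<subseteq> C" "C \<inter> B = {}" "C \<inter> A = {}"
        using bspec[OF few_AB[OF 4(1)] that(1)] bspec[OF few_BA[OF 4(2)] that(1)] that(2,3) by satx+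
      ultimately show ?thesis
        by blast
    qed
    then have "P \<subseteq> {A, B, {1..n} - A - B}"
      by blast
    then show False
      by (rule tight_edge_contradiction[OF P AB bdP])
  qed
qed

section \<open>Components after deleting a vertex set\<close>

context
  fixes S :: "nat set set"
  assumes S: "S \<subseteq> V"
begin

abbreviation W :: "nat set set" where
  "W \<equiv> V - S"

abbreviation conn :: "(nat set \<times> nat set) set" where
  "conn \<equiv> (kneser_edges W)\<^sup>*"

abbreviation c :: nat where
  "c \<equiv> num_components W"

lemma conn_sym: "(A, B) \<in> conn \<Longrightarrow> (B, A) \<in> conn"
proof -
  have "sym (kneser_edges W)"
    by (auto simp: sym_def kneser_edges_def)
  then show "(A, B) \<in> conn \<Longrightarrow> (B, A) \<in> conn"
    using sym_rtrancl by (metis symD)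
qed

lemma conn_in_W: "(A, B) \<in> conn \<Longrightarrow> A \<in> W \<Longrightarrow> B \<in> W"
  by (induction rule: rtrancl_induct) (auto simp: kneser_edges_def)

lemma edge_conn: "A \<in> W \<Longrightarrow> B \<in> W \<Longrightarrow> A \<inter> B = {} \<Longrightarrow> (A, B) \<in> conn"
  by (rule r_into_rtrancl) (auto simp: kneser_edges_def)

lemma component_eq:
  assumes "B \<in> conn `` {A}"
  shows "conn `` {B} = conn `` {A}"
  using assms conn_sym by (auto intro: rtrancl_trans)

lemma finite_W: "finite W"
  using finite_V by simp

text \<open>\<open>I\<close> represents the components other than that of \<open>A\<close>. Keeping
  \<open>I\<close> fixed while \<open>B\<close> varies allows adjacent vertices to be tested against
  the same family.\<close>

lemma transversal:
  assumes "A \<in> W"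
  obtains I where "I \<subseteq> W" "card I = c - 1"
    "\<And>B. B \<in> conn `` {A} \<Longrightarrow> B \<notin> I \<and> intersecting (insert B I)"
proof -
  define rep where "rep Q = (SOME B. B \<in> Q)" for Q :: "nat set set"
  define Qs where "Qs = W // conn - {conn `` {A}}"
  have rep: "rep Q \<in> W \<and> conn `` {rep Q} = Q" if "Q \<in> W // conn" for Q
  proof -
    obtain B where B: "B \<in> W" "Q = conn `` {B}"
      using \<open>Q \<in> W // conn\<close> by (auto elim: quotientE)
    then have "B \<in> Q"
      by simp
    then have "rep Q \<in> Q"
      unfolding rep_def by (rule someI)
    then show ?thesis
      using B component_eq conn_in_W by blast
  qed
  define I where "I = rep ` Qs"
  have inj: "inj_on rep Qs"
    using rep by (intro inj_onI) (metis DiffD1 Qs_def)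
  have "conn `` {A} \<in> W // conn"
    using assms by (rule quotientI)
  then have "card I = c - 1"
    using inj by (simp add: I_def card_image Qs_def num_components_def)
  moreover have IW: "I \<subseteq> W"
    using rep by (auto simp: I_def Qs_def)
  moreover have "B \<notin> I \<and> intersecting (insert B I)" if B: "B \<in> conn `` {A}" for B
  proof
    have BW: "B \<in> W"
      using conn_in_W assms B by blast
    have cB: "conn `` {B} = conn `` {A}"
      using component_eq[OF B] .
    have cI: "conn `` {C} \<in> Qs \<and> rep (conn `` {C}) = C" if "C \<in> I" for C
      using that rep by (auto simp: I_def Qs_def)
    show "B \<notin> I"
      using cI[of B] cB by (auto simp: Qs_def)
    have same: "C = D" if "C \<in> insert B I" "D \<in> insert B I" "conn `` {C} = conn `` {D}" for C D
      using that cI cB by (metis DiffD2 Qs_def insertE insertI1)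
    have "C \<inter> D \<noteq> {}" if CD: "C \<in> insert B I" "D \<in> insert B I" for C D
    proof
      assume disj: "C \<inter> D = {}"
      have CW: "C \<in> W" "D \<in> W"
        using CD BW IW by auto
      then have "D \<in> conn `` {C}"
        using edge_conn disj by blast
      then have "C = D"
        using same[OF CD] component_eq by metis
      then show False
        using disj CW k_ge by (auto simp: V_iff)
    qed
    then show "intersecting (insert B I)"
      unfolding intersecting_def by blast
  qed
  ultimately show thesis
    using that by blast
qed

lemma num_components_intersecting:
  assumes "intersecting W"
  shows "c = card W"
proof -
  have "kneser_edges W = {}"
    using assms by (auto simp: kneser_edges_def intersecting_def)
  then have "W // conn = (\<lambda>A. {A}) ` W"
    by (auto simp: quotient_def)
  then show ?thesis
    by (simp add: num_components_def card_image)
qed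

lemma intersecting_if_many_components:
  assumes "((n - 1) choose (k - 1)) + 1 < c + ((n - k - 1) choose (k - 1))"
  shows "intersecting W"
proof (rule ccontr)
  assume "\<not> intersecting W"
  then obtain A B where AB: "A \<in> W" "B \<in> W" "A \<inter> B = {}"
    by (auto simp: intersecting_def)
  obtain I where I: "I \<subseteq> W" "card I = c - 1"
    "\<And>B. B \<in> conn `` {A} \<Longrightarrow> B \<notin> I \<and> intersecting (insert B I)"
    using transversal[OF AB(1)] by blast
  have finI: "finite I"
    using I(1) finite_W finite_subset by blast
  have "(n - k - 1) choose (k - 1) \<le> (n - 1) choose (k - 1)"
    by (rule binomial_right_mono) simp
  then have "1 < c"
    using assms by linarith
  have center: "\<exists>x\<in>C. \<forall>D\<in>I. x \<in> D" if C: "C \<in> conn `` {A}" for C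
  proof -
    have CW: "C \<in> W"
      using conn_in_W AB(1) C by blast
    have "card (insert C I) = c"
      using I(3)[OF C] I(2) finI \<open>1 < c\<close> by simp
    moreover have "insert C I \<subseteq> ksub {1..n} k"
      using CW I(1) V_eq by blast
    ultimately have "\<not> nontrivial (insert C I)"
      using hilton_milner[of "{1..n}" k "insert C I"] n_ge I(3)[OF C] assms
      by (auto simp: HM_family_def)
    then show ?thesis
      by (auto simp: nontrivial_def)
  qed
  have "A \<in> conn `` {A}" "B \<in> conn `` {A}"
    using edge_conn[OF AB] by auto
  \<comment> \<open>The centres lie in the disjoint sets \<open>A\<close> and \<open>B\<close>, so
    all of \<open>I\<close> shares two distinct elements.\<close>
  note center[OF this(1)] center[OF this(2)]
  then obtain x y where xy: "x \<in> A" "\<forall>D\<in>I. x \<in> D" "y \<in> B" "\<forall>D\<in>I. y \<in> D"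
    by blast
  then have ne: "x \<noteq> y" and x: "x \<in> {1..n}" and y: "y \<in> {1..n}"
    using AB by (auto simp: V_iff)
  have "I \<subseteq> {D \<in> ksub {1..n} k. x \<in> D \<and> D \<inter> {y} \<noteq> {}}"
    using I(1) xy V_eq by auto
  then have "card I \<le> card {D \<in> ksub {1..n} k. x \<in> D \<and> D \<inter> {y} \<noteq> {}}"
    by (intro card_mono) (auto simp: finite_ksub)
  then have "card I + ((n - 1 - 1) choose (k - 1)) \<le> (n - 1) choose (k - 1)"
    using card_star_meeting[of "{1..n}" x k "{y}"] x y ne k_ge by simp
  moreover have "(n - k - 1) choose (k - 1) \<le> (n - 1 - 1) choose (k - 1)"
    using k_ge by (intro binomial_right_mono) simp
  ultimately show False
    using assms I(2) \<open>1 < c\<close> by linarith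
qed

text \<open>Turns components into fragments: the exterior contains representatives of all other
  components.\<close>

lemma component_boundary:
  assumes "A \<in> W"
  shows "conn `` {A} \<subseteq> W" "bd (conn `` {A}) \<subseteq> S" "c - 1 \<le> card (ext (conn `` {A}))"
proof -
  let ?Q = "conn `` {A}"
  show QW: "?Q \<subseteq> W"
    using conn_in_W assms by blast
  show bdS: "bd ?Q \<subseteq> S"
  proof
    fix B assume "B \<in> bd ?Q"
    then obtain C where C: "B \<in> V" "B \<notin> ?Q" "C \<in> ?Q" "C \<inter> B = {}"
      by (auto simp: bd_def)
    show "B \<in> S"
    proof (rule ccontr)
      assume "B \<notin> S"
      then have "(C, B) \<in> conn"
        using C QW by (intro edge_conn) auto
      then show False
        using C by (auto intro: rtrancl_trans)
    qed
  qed
  obtain I where I: "I \<subseteq> W" "card I = c - 1"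
    "\<And>B. B \<in> ?Q \<Longrightarrow> B \<notin> I \<and> intersecting (insert B I)"
    using transversal[OF assms] by blast
  have "I \<subseteq> ext ?Q"
    using I(1,3) bdS unfolding ext_def by blast
  then show "c - 1 \<le> card (ext ?Q)"
    using I(2) finite_V by (metis card_mono ext_def finite_Diff)
qed

text \<open>For \<open>c \<ge> 3\<close>, \<open>card S \<le> d\<close> would make every component a
  single vertex with neighbourhood \<open>S\<close>, and \<open>nbh_inject\<close> allows only one
  such vertex.\<close>

lemma card_cut_ge:
  assumes "2 \<le> c"
  shows "d \<le> card S" and "3 \<le> c \<Longrightarrow> d < card S"
proof -
  have finS: "finite S"
    using S finite_V finite_subset by blast
  have finQ: "finite (conn `` {A})" if "A \<in> W" for A
    using component_boundary(1)[OF that] finite_W finite_subset by blast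
  have bd_le: "card (bd (conn `` {A})) \<le> card S" if "A \<in> W" for A
    using component_boundary(2)[OF that] finS by (rule card_mono[rotated])
  have "W // conn \<noteq> {}"
    using assms unfolding num_components_def by (metis card.empty not_numeral_le_zero)
  then obtain A where A: "A \<in> W"
    by (auto elim: quotientE)
  have "fragment 1 (conn `` {A})"
    using component_boundary(1,3)[OF A] assms card_gt_0_iff[of "conn `` {A}"] finQ[OF A]
    unfolding fragment_def by fastforce
  then show "d \<le> card S"
    using card_bd_ge bd_le[OF A] by (meson order_trans)
  assume c3: "3 \<le> c"
  show "d < card S"
  proof (rule ccontr)
    assume "\<not> d < card S"
    have S_eq: "nbh B = S \<and> conn `` {B} = {B}" if B: "B \<in> W" for B
    proof -
      have "\<not> 2 \<le> card (conn `` {B})"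
      proof
        assume "2 \<le> card (conn `` {B})"
        then have "fragment 2 (conn `` {B})"
          using component_boundary(1,3)[OF B] c3 by (auto simp: fragment_def)
        then show False
          using card_bd_gt bd_le[OF B] \<open>\<not> d < card S\<close> by fastforce
      qed
      then have "card (conn `` {B}) \<le> Suc 0"
        by simp
      then have QB: "conn `` {B} = {B}"
        using card_le_Suc0_iff_eq[OF finQ[OF B]] by blast
      have "B \<noteq> {}"
        using B k_ge by (auto simp: V_iff)
      then have "nbh B = bd {B}"
        by (auto simp: nbh_def bd_def)
      then have "nbh B \<subseteq> S"
        using component_boundary(2)[OF B] QB by simp
      moreover have "card S \<le> card (nbh B)"
        using card_nbh[of B] B \<open>\<not> d < card S\<close> by simp
      ultimately show ?thesis
        using card_seteq[OF finS] QB by blast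
    qed
    then have "B = A" if "B \<in> W" for B
      using nbh_inject[of B A] A that by blast
    then have "W // conn \<subseteq> {conn `` {A}}"
      by (auto elim: quotientE)
    then have "c \<le> 1"
      unfolding num_components_def using card_mono[of "{conn `` {A}}"] by fastforce
    then show False
      using c3 by simp
  qed
qed

lemma card_W: "card W + card S = n choose k"
proof -
  have "finite S"
    using S finite_V finite_subset by blast
  then have "card W = card V - card S"
    using S by (simp add: card_Diff_subset)
  moreover have "card S \<le> card V"
    using S finite_V by (rule card_mono[rotated])
  moreover have "card V = n choose k"
    by (simp add: V_eq card_ksub)
  ultimately show ?thesis
    by simp
qed

end

lemma kneser_independent_iff: "kneser_independent n k I \<longleftrightarrow> I \<subseteq> V \<and> intersecting I"
  by (simp add: kneser_independent_def intersecting_def)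

text \<open>The star of \<open>1\<close> attains the Erdos-Ko-Rado bound, so being maximum means
  having that size.\<close>

lemma kneser_max_independent_iff:
  "kneser_max_independent n k I \<longleftrightarrow>
    I \<subseteq> V \<and> intersecting I \<and> card I = (n - 1) choose (k - 1)"
proof -
  have le: "card J \<le> (n - 1) choose (k - 1)" if "kneser_independent n k J" for J
    using card_intersecting_le[of "{1..n}" k J] that n_ge k_ge
    by (simp add: kneser_independent_iff V_eq)
  let ?star = "{A \<in> ksub {1..n} k. 1 \<in> A}"
  have "kneser_independent n k ?star"
    by (auto simp: kneser_independent_iff V_eq intersecting_def)
  moreover have "card ?star = (n - 1) choose (k - 1)"
    using card_star[of "{1..n}" 1 k] n_ge k_ge by simp
  ultimately show ?thesis
    using le unfolding kneser_max_independent_def kneser_independent_iff by (metis le_antisym)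
qed

end

section \<open>Clearing denominators and the ranges of \<open>c\<close>\<close>

lemma ratio_ge_iff:
  assumes "0 < c" "0 < (k::nat)" "k \<le> n"
  shows "real s / real c \<ge> real n / real k - 1 \<longleftrightarrow> (n - k) * c \<le> k * s"
    and "real s / real c = real n / real k - 1 \<longleftrightarrow> (n - k) * c = k * s"
proof -
  have eq: "real n / real k - 1 = real (n - k) / real k"
    using assms by (simp add: field_simps of_nat_diff)
  have "real n / real k - 1 \<le> real s / real c \<longleftrightarrow> real (n - k) * real c \<le> real k * real s"
    unfolding eq using assms by (simp add: divide_simps mult.commute del: of_nat_diff)
  then show "real s / real c \<ge> real n / real k - 1 \<longleftrightarrow> (n - k) * c \<le> k * s"
    by (simp only: of_nat_mult[symmetric] of_nat_le_iff)
  have "real s / real c = real n / real k - 1 \<longleftrightarrow> real (n - k) * real c = real k * real s"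
    unfolding eq using assms by (auto simp: divide_simps mult.commute simp del: of_nat_diff)
  then show "real s / real c = real n / real k - 1 \<longleftrightarrow> (n - k) * c = k * s"
    by (simp only: of_nat_mult[symmetric] of_nat_eq_iff)
qed

theorem theorem3p1:
  fixes n k :: nat and S :: "nat set set"
  assumes "k \<ge> 3" and "n \<ge> 2 * k + 1"
    and "kneser_vertex_cut n k S"
  defines "c \<equiv> num_components (kneser_verts n k - S)"
  shows "(((n - k - 1) choose (k - 1)) + 1 \<le> c \<and>
           c \<le> ((n - 1) choose (k - 1)) - ((n - k - 1) choose (k - 1)) + 1)
         \<or> (real (card S) / real c \<ge> real n / real k - 1 \<and>
            (real (card S) / real c = real n / real k - 1 \<longleftrightarrow>
               (\<exists>I. kneser_max_independent n k I \<and> S = kneser_verts n k - I)))"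
proof -
  interpret kneser n k
    using assms(1,2) by unfold_locales
  let ?W = "V - S" and ?\<alpha> = "(n - 1) choose (k - 1)" and ?m = "(n - k - 1) choose (k - 1)"
  have S: "S \<subseteq> V" and c2: "2 \<le> c"
    using assms(3) by (auto simp: kneser_vertex_cut_def c_def)
  have pos: "0 < c" "0 < k" "k \<le> n"
    using c2 assms(1,2) by auto
  have max_iff: "(\<exists>I. kneser_max_independent n k I \<and> S = V - I) \<longleftrightarrow>
      intersecting ?W \<and> card ?W = ?\<alpha>"
  proof
    assume "\<exists>I. kneser_max_independent n k I \<and> S = V - I"
    then obtain I where I: "kneser_max_independent n k I" "S = V - I"
      by blast
    then have "?W = I"
      by (auto simp: kneser_max_independent_iff)
    then show "intersecting ?W \<and> card ?W = ?\<alpha>"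
      using I(1) by (simp add: kneser_max_independent_iff)
  next
    assume "intersecting ?W \<and> card ?W = ?\<alpha>"
    then show "\<exists>I. kneser_max_independent n k I \<and> S = V - I"
      using S by (intro exI[of _ ?W]) (auto simp: kneser_max_independent_iff)
  qed
  have m_less: "?m < ?\<alpha>"
  proof -
    have "?m \<le> (n - 1 - 1) choose (k - 1)"
      using assms(1) by (intro binomial_right_mono) simp
    moreover have "?\<alpha> = ((n - 1 - 1) choose (k - 1 - 1)) + ((n - 1 - 1) choose (k - 1))"
      using assms(1,2) by (intro choose_reduce_nat) auto
    moreover have "0 < (n - 1 - 1) choose (k - 1 - 1)"
      using assms(1,2) by (intro zero_less_binomial) auto
    ultimately show ?thesis
      by linarith
  qed
  consider "c \<le> ?m" | "?\<alpha> + 1 < c + ?m" | "?m + 1 \<le> c" "c \<le> ?\<alpha> - ?m + 1"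
    using m_less by linarith
  then show ?thesis
  proof cases
    case 1
    have m3: "3 \<le> ?m"
    proof -
      have "k = k choose (k - 1)"
        using assms(1) binomial_symmetric[of "k - 1" k] by simp
      also have "\<dots> \<le> ?m"
        using assms(2) by (intro binomial_right_mono) simp
      finally show ?thesis
        using assms(1) by linarith
    qed
    \<comment> \<open>By absorption, a cut of size \<open>d\<close> meets the ratio bound with
      equality exactly when \<open>c = ?m\<close>.\<close>
    have "k * d = (n - k) * ?m"
      using times_binomial_minus1_eq[of k "n - k"] assms(1) by simp
    \<comment> \<open>Strictness comes from \<open>2 < ?m\<close> when \<open>c = 2\<close>, and
      from \<open>d < card S\<close> when \<open>c \<ge> 3\<close>.\<close>
    have "(n - k) * c < k * card S"
    proof (cases "c = 2")
      case True
      have "(n - k) * c < (n - k) * ?m"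
        using True m3 assms(1,2) by (intro mult_strict_left_mono) auto
      also have "\<dots> = k * d"
        using \<open>k * d = (n - k) * ?m\<close> by simp
      also have "\<dots> \<le> k * card S"
        using card_cut_ge(1)[OF S] c2 by (simp add: c_def)
      finally show ?thesis .
    next
      case False
      have "(n - k) * c \<le> (n - k) * ?m"
        using 1 by (intro mult_left_mono) auto
      also have "\<dots> = k * d"
        using \<open>k * d = (n - k) * ?m\<close> by simp
      also have "\<dots> < k * card S"
        using card_cut_ge(2)[OF S] c2 False assms(1) by (simp add: c_def)
      finally show ?thesis .
    qed
    \<comment> \<open>The complement of a maximum independent set would have
      \<open>c = ?\<alpha>\<close>, beyond this range.\<close>
    moreover have "\<not> (intersecting ?W \<and> card ?W = ?\<alpha>)"
      using num_components_intersecting[OF S] 1 m_less by (auto simp: c_def)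
    ultimately show ?thesis
      unfolding max_iff ratio_ge_iff[OF pos] by simp
  next
    case 2
    then have W: "intersecting ?W"
      unfolding c_def by (rule intersecting_if_many_components[OF S])
    then have c_eq: "c = card ?W"
      unfolding c_def by (rule num_components_intersecting[OF S])
    have "c \<le> ?\<alpha>"
      using card_intersecting_le[of "{1..n}" k ?W] W assms(1,2) V_eq c_eq by auto
    \<comment> \<open>Since \<open>card ?W = c\<close>, the ratio bound becomes
      \<open>n * c \<le> n * ?\<alpha>\<close>, with equality exactly at the Erdos-Ko-Rado
      bound.\<close>
    have "k * card S + k * c = n * ?\<alpha>"
      using card_W[OF S] times_binomial_minus1_eq[of k n] assms(1) c_eq
      by (simp add: distrib_left[symmetric] add.commute)
    moreover have "(n - k) * c + k * c = n * c"
      using pos(3) by (simp add: distrib_right[symmetric])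
    moreover have "n * c \<le> n * ?\<alpha>" "n * c = n * ?\<alpha> \<longleftrightarrow> c = ?\<alpha>"
      using \<open>c \<le> ?\<alpha>\<close> pos by auto
    ultimately have "(n - k) * c \<le> k * card S" "(n - k) * c = k * card S \<longleftrightarrow> c = ?\<alpha>"
      by linarith+
    then show ?thesis
      unfolding max_iff ratio_ge_iff[OF pos] using W c_eq by simp
  qed blast
qed

end
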